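(* Let $\delta\in\{0,\frac12\}$. Suppose $V$ is an $\mathcal{S}(\delta)$-module such that $V_{\bar0}$ and $V_{\bar1}$ are free $\mathbb{C}[L_0]$-modules of rank $1$ by restriction. If $\mathcal{S}(\delta)_{\bar1}V\neq0$, then $V$ is isomorphic to $\Omega_{\mathcal{S}(\delta)}(\lambda,a,b)$, $\Omega'_{\mathcal{S}(\delta)}(\lambda,a,b)$, $\Omega''_{\mathcal{S}(\delta)}(\lambda,b)$ or $\tilde\Omega''_{\mathcal{S}(\delta)}(\lambda,b)$ up to a parity-change for some $\lambda,b\in\mathbb{C}^*$ and some $a\in\mathbb{C}$.
   Context: All vector spaces and algebras are over $\mathbb{C}$; $\mathbb{C}^*$ is the set of nonzero complex numbers. Modules $V=V_{\bar0}\oplus V_{\bar1}$ over Lie superalgebras are $\mathbb{Z}_2$-graded; a parity-change interchanges $V_{\bar 0}$ and $V_{\bar 1}$. The Fermion-Virasoro algebra $\mathcal{S}(\delta)=\mathcal{S}(\delta)_{\bar0}\oplus\mathcal{S}(\delta)_{\bar1}$ is the Lie superalgebra with basis $\{L_m,\psi_n,c,z:m\in\mathbb{Z},n\in\mathbb{Z}+\delta\}$, $L_m,c,z$ even, $\psi_n$ odd, with $$[L_m,L_n]=(m-n)L_{m+n}+\delta_{m,-n}\tfrac{m^3-m}{12}c,\quad [L_m,\psi_n]=(-n-\tfrac m2)\psi_{m+n},\quad [\psi_m,\psi_n]=\delta_{m,-n}z$$ (with $\delta_{m,-n}$ the Kronecker symbol) and $c,z$ central. For $\lambda\in\mathbb{C}^*$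 fix $\sqrt\lambda\in\mathbb{C}^*$ with $(\sqrt\lambda)^2=\lambda$ and set $\lambda^r=\lambda^{r-\frac12}\sqrt\lambda$ for $r\in\frac12+\mathbb{Z}$. For $\lambda\in\mathbb{C}^*$, $a,b\in\mathbb{C}$ define $\mathcal{S}(\delta)$-modules as follows, with $m\in\mathbb{Z}$, $r\in\delta+\mathbb{Z}$, and $f,g$ arbitrary polynomials in the indicated variable; in all of them $c$ and $z$ act as $0$ and $\psi_r$ acts as $0$ on the odd part. (i) $\Omega_{\mathcal{S}(\delta)}(\lambda,a,b)=\mathbb{C}[x_0]\oplus\mathbb{C}[x_1]$ with even part $\mathbb{C}[x_0]$ and odd part $\mathbb{C}[x_1]$: $L_m\cdot f(x_0)=\lambda^m(x_0+ma)f(x_0+m)$, $L_m\cdot g(x_1)=\lambda^m(x_1-\frac m2+ma)g(x_1+m)$, $\psi_r\cdot f(x_0)=b\lambda^rf(x_1+r)$. (ii) $\Omega'_{\mathcal{S}(\delta)}(\lambda,a,b)=\mathbb{C}[y_0]\oplus\mathbb{C}[y_1]$ with even part $\mathbb{C}[y_0]$ and odd part $\mathbb{C}[y_1]$: $L_m\cdot f(y_0)=\lambda^m(y_0+ma)f(y_0+m)$, $L_m\cdot g(y_1)=\lambda^m(y_1-\frac{3m}2+ma)g(y_1+m)$, $\psi_r\cdot f(y_0)=b\lambda^r(y_1-2ra+3r)f(y_1+r)$. (iii) $\Omega''_{\mathcal{S}(\delta)}(\lambda,b)=\mathbb{C}[z_0]\oplus\mathbb{C}[z_1]$ with even part $\mathbb{C}[z_0]$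 and odd part $\mathbb{C}[z_1]$: $L_m\cdot f(z_0)=\lambda^m(z_0+m)f(z_0+m)$, $L_m\cdot g(z_1)=\lambda^m(z_1-\frac32m)g(z_1+m)$, $\psi_r\cdot f(z_0)=b\lambda^r(z_1+3r)(z_1+r)f(z_1+r)$. (iv) $\tilde\Omega''_{\mathcal{S}(\delta)}(\lambda,b)=\mathbb{C}[\tilde z_0]\oplus\mathbb{C}[\tilde z_1]$ with even part $\mathbb{C}[\tilde z_0]$ and odd part $\mathbb{C}[\tilde z_1]$: $L_m\cdot f(\tilde z_0)=\lambda^m(\tilde z_0+\frac52m)f(\tilde z_0+m)$, $L_m\cdot g(\tilde z_1)=\lambda^m\tilde z_1g(\tilde z_1+m)$, $\psi_r\cdot f(\tilde z_0)=b\lambda^r\tilde z_1(\tilde z_1-2r)f(\tilde z_1+r)$. *)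

theory Defs
  imports
    Complex_Main
    "HOL-Library.Poly_Mapping"
    "HOL-Library.Product_Plus"
    "HOL-Library.Z2"
    "HOL-Computational_Algebra.Polynomial"
begin

section \<open>Lie superalgebras over the complex numbers and their graded modules\<close>

record 'v super_space =
  scl :: "complex \<Rightarrow> 'v \<Rightarrow> 'v"
  part :: "bit \<Rightarrow> 'v set"

record 'g lie_super = "'g super_space" +
  brk :: "'g \<Rightarrow> 'g \<Rightarrow> 'g"

record ('g, 'v) super_module = "'v super_space" +
  act :: "'g \<Rightarrow> 'v \<Rightarrow> 'v"

locale super_vector_space = vector_space "scl V"
  for V :: "('v::ab_group_add, 'm) super_space_scheme" +
  assumes subspace_part: "subspace (part V i)"
    and part_disjoint: "part V 0 \<inter> part V 1 = {0}"
    and part_sum: "\<exists>u\<in>part V 0. \<exists>w\<in>part V 1. v = u + w"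

definition super_sign :: "bit \<Rightarrow> bit \<Rightarrow> complex" where
  "super_sign i j = (if i = 1 \<and> j = 1 then -1 else 1)"

locale lie_superalgebra = super_vector_space G
  for G :: "('g::ab_group_add, 'm) lie_super_scheme" +
  assumes linear_brk_left: "Vector_Spaces.linear (scl G) (scl G) (\<lambda>x. brk G x y)"
    and linear_brk_right: "Vector_Spaces.linear (scl G) (scl G) (\<lambda>y. brk G x y)"
    and brk_part: "x \<in> part G i \<Longrightarrow> y \<in> part G j \<Longrightarrow> brk G x y \<in> part G (i + j)"
    and brk_skew: "x \<in> part G i \<Longrightarrow> y \<in> part G j \<Longrightarrow>
      brk G x y = - scl G (super_sign i j) (brk G y x)"
    and jacobi: "x \<in> part G i \<Longrightarrow> y \<in> part G j \<Longrightarrow>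
      brk G x (brk G y z) = brk G (brk G x y) z + scl G (super_sign i j) (brk G y (brk G x z))"

locale lie_super_module = G: lie_superalgebra G + V: super_vector_space V
  for G :: "('g::ab_group_add, 'm) lie_super_scheme"
    and V :: "('g, 'v::ab_group_add, 'n) super_module_scheme" +
  assumes linear_act_left: "Vector_Spaces.linear (scl G) (scl V) (\<lambda>x. act V x v)"
    and linear_act_right: "Vector_Spaces.linear (scl V) (scl V) (\<lambda>v. act V x v)"
    and act_part: "x \<in> part G i \<Longrightarrow> v \<in> part V j \<Longrightarrow> act V x v \<in> part V (i + j)"
    and act_brk: "x \<in> part G i \<Longrightarrow> y \<in> part G j \<Longrightarrow>
      act V (brk G x y) v = act V x (act V y v) - scl V (super_sign i j) (act V y (act V x v))"

definition super_module_iso ::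
    "('g, 'v::ab_group_add) super_module \<Rightarrow> ('g, 'w::ab_group_add) super_module \<Rightarrow> bool" where
  "super_module_iso V W \<longleftrightarrow>
    (\<exists>\<phi>. Vector_Spaces.linear (scl V) (scl W) \<phi> \<and> bij \<phi> \<and> (\<forall>i. \<phi> ` part V i = part W i) \<and>
      (\<forall>x v. \<phi> (act V x v) = act W x (\<phi> v)))"

definition parity_change :: "('g, 'v) super_module \<Rightarrow> ('g, 'v) super_module" where
  "parity_change V = V\<lparr>part := \<lambda>i. part V (i + 1)\<rparr>"

definition iso_up_to_parity ::
    "('g, 'v::ab_group_add) super_module \<Rightarrow> ('g, 'w::ab_group_add) super_module \<Rightarrow> bool" where
  "iso_up_to_parity V W \<longleftrightarrow> super_module_iso V W \<or> super_module_iso V (parity_change W)"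

text \<open>The action \<open>p(T) v\<close> of a polynomial \<open>p\<close> in the operator \<open>T\<close>.\<close>

definition op_poly :: "(complex \<Rightarrow> 'v \<Rightarrow> 'v) \<Rightarrow> ('v \<Rightarrow> 'v) \<Rightarrow> complex poly \<Rightarrow> 'v \<Rightarrow> 'v::ab_group_add"
  where "op_poly s T p v = (\<Sum>k\<le>degree p. s (coeff p k) ((T ^^ k) v))"

text \<open>\<open>W\<close>, a \<open>T\<close>-stable subspace, is free of rank \<open>1\<close> over the polynomial ring in \<open>T\<close>:
  it has a basis \<open>{w}\<close> over that ring.\<close>

definition free_rank_one :: "(complex \<Rightarrow> 'v \<Rightarrow> 'v) \<Rightarrow> ('v \<Rightarrow> 'v) \<Rightarrow> 'v::ab_group_add set \<Rightarrow> bool"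
  where "free_rank_one s T W \<longleftrightarrow> (\<exists>w\<in>W. bij_betw (\<lambda>p. op_poly s T p w) UNIV W)"


section \<open>The Fermion-Virasoro algebra\<close>

text \<open>The generator \<open>Psi k\<close> stands for \<open>\<psi>\<^sub>n\<close> with \<open>n = k + \<delta>\<close>, so that the index \<open>k\<close> is an integer
  for both values of \<open>\<delta>\<close>. In particular \<open>[\<psi>\<^sub>m, \<psi>\<^sub>n]\<close> for \<open>m = j + \<delta>\<close>, \<open>n = k + \<delta>\<close> is nonzero
  if and only if \<open>j + k + 2\<delta> = 0\<close>. The underlying vector space consists of the finitely supported
  coefficient functions on the generators.\<close>

datatype fv_gen = L int | Psi int | Cc | Zz

type_synonym fv = "fv_gen \<Rightarrow>\<^sub>0 complex"

definition fv_scale :: "complex \<Rightarrow> fv \<Rightarrow> fv" where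
  "fv_scale a x = Poly_Mapping.map ((*) a) x"

abbreviation gen :: "fv_gen \<Rightarrow> fv" where
  "gen g \<equiv> Poly_Mapping.single g 1"

primrec fv_parity :: "fv_gen \<Rightarrow> bit" where
  "fv_parity (L m) = 0"
| "fv_parity (Psi k) = 1"
| "fv_parity Cc = 0"
| "fv_parity Zz = 0"

definition fv_extend :: "(complex \<Rightarrow> 'v \<Rightarrow> 'v) \<Rightarrow> (fv_gen \<Rightarrow> 'v) \<Rightarrow> fv \<Rightarrow> 'v::ab_group_add" where
  "fv_extend s f x = (\<Sum>g\<in>Poly_Mapping.keys x. s (Poly_Mapping.lookup x g) (f g))"

fun fv_brk_gen :: "complex \<Rightarrow> fv_gen \<Rightarrow> fv_gen \<Rightarrow> fv" where
  "fv_brk_gen \<delta> (L m) (L n) =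
     fv_scale (of_int (m - n)) (gen (L (m + n))) +
     (if m = - n then fv_scale (of_int (m ^ 3 - m) / 12) (gen Cc) else 0)"
| "fv_brk_gen \<delta> (L m) (Psi k) =
     fv_scale (- (of_int k + \<delta>) - of_int m / 2) (gen (Psi (m + k)))"
| "fv_brk_gen \<delta> (Psi k) (L m) =
     - fv_scale (- (of_int k + \<delta>) - of_int m / 2) (gen (Psi (m + k)))"
| "fv_brk_gen \<delta> (Psi j) (Psi k) =
     (if of_int j + \<delta> = - (of_int k + \<delta>) then gen Zz else 0)"
| "fv_brk_gen \<delta> _ _ = 0"

definition fermion_virasoro :: "complex \<Rightarrow> fv lie_super" where
  "fermion_virasoro \<delta> =
    \<lparr>scl = fv_scale,
     part = \<lambda>i. {x. \<forall>g\<in>Poly_Mapping.keys x. fv_parity g = i},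
     brk = \<lambda>x y. fv_extend fv_scale (\<lambda>g. fv_extend fv_scale (fv_brk_gen \<delta> g) y) x\<rparr>"


section \<open>The four families of modules\<close>

text \<open>\<open>lam_pow \<rho> \<delta> lam k\<close> is \<open>\<lambda>\<^sup>r\<close> for \<open>r = k + \<delta>\<close> and \<open>\<delta> \<in> {0, 1/2}\<close>, where \<open>\<rho>\<close> is the chosen
  square root function.\<close>

definition lam_pow :: "(complex \<Rightarrow> complex) \<Rightarrow> complex \<Rightarrow> complex \<Rightarrow> int \<Rightarrow> complex" where
  "lam_pow \<rho> \<delta> lam k = (if \<delta> = 0 then lam powi k else lam powi k * \<rho> lam)"

definition shift_poly :: "complex \<Rightarrow> complex poly \<Rightarrow> complex poly" where
  "shift_poly c f = pcompose f [:c, 1:]"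

text \<open>A module on \<open>\<complex>[x\<^sub>0] \<oplus> \<complex>[x\<^sub>1]\<close>, realized as pairs of polynomials, with
  \<open>L\<^sub>m f(x\<^sub>0) = \<lambda>\<^sup>m p\<^sub>m(x\<^sub>0) f(x\<^sub>0 + m)\<close>, \<open>L\<^sub>m g(x\<^sub>1) = \<lambda>\<^sup>m q\<^sub>m(x\<^sub>1) g(x\<^sub>1 + m)\<close>,
  \<open>\<psi>\<^sub>r f(x\<^sub>0) = b \<lambda>\<^sup>r s\<^sub>r(x\<^sub>1) f(x\<^sub>1 + r)\<close>, and \<open>\<psi>\<^sub>r g(x\<^sub>1) = 0\<close>.\<close>

fun poly_act_gen ::
    "(complex \<Rightarrow> complex) \<Rightarrow> complex \<Rightarrow> complex \<Rightarrow> complex \<Rightarrow>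
     (complex \<Rightarrow> complex poly) \<Rightarrow> (complex \<Rightarrow> complex poly) \<Rightarrow> (complex \<Rightarrow> complex poly) \<Rightarrow>
     fv_gen \<Rightarrow> complex poly \<times> complex poly \<Rightarrow> complex poly \<times> complex poly" where
  "poly_act_gen \<rho> \<delta> lam b p q s (L m) (f, g) =
     (smult (lam powi m) (p (of_int m) * shift_poly (of_int m) f),
      smult (lam powi m) (q (of_int m) * shift_poly (of_int m) g))"
| "poly_act_gen \<rho> \<delta> lam b p q s (Psi k) (f, g) =
     (0, smult (b * lam_pow \<rho> \<delta> lam k) (s (of_int k + \<delta>) * shift_poly (of_int k + \<delta>) f))"
| "poly_act_gen \<rho> \<delta> lam b p q s Cc (f, g) = (0, 0)"
| "poly_act_gen \<rho> \<delta> lam b p q s Zz (f, g) = (0, 0)"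

definition pair_scale ::
    "complex \<Rightarrow> complex poly \<times> complex poly \<Rightarrow> complex poly \<times> complex poly" where
  "pair_scale a v = (smult a (fst v), smult a (snd v))"

definition poly_module ::
    "(complex \<Rightarrow> complex) \<Rightarrow> complex \<Rightarrow> complex \<Rightarrow> complex \<Rightarrow>
     (complex \<Rightarrow> complex poly) \<Rightarrow> (complex \<Rightarrow> complex poly) \<Rightarrow> (complex \<Rightarrow> complex poly) \<Rightarrow>
     (fv, complex poly \<times> complex poly) super_module" where
  "poly_module \<rho> \<delta> lam b p q s =
    \<lparr>scl = pair_scale,
     part = \<lambda>i. if i = 0 then {(f, 0) | f. True} else {(0, g) | g. True},
     act = \<lambda>x v. fv_extend pair_scale (\<lambda>g. poly_act_gen \<rho> \<delta> lam b p q s g v) x\<rparr>"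

definition Omega :: "(complex \<Rightarrow> complex) \<Rightarrow> complex \<Rightarrow> complex \<Rightarrow> complex \<Rightarrow> complex \<Rightarrow>
    (fv, complex poly \<times> complex poly) super_module" where
  "Omega \<rho> \<delta> lam a b = poly_module \<rho> \<delta> lam b
     (\<lambda>m. [:m * a, 1:])
     (\<lambda>m. [:- (m / 2) + m * a, 1:])
     (\<lambda>r. 1)"

definition Omega' :: "(complex \<Rightarrow> complex) \<Rightarrow> complex \<Rightarrow> complex \<Rightarrow> complex \<Rightarrow> complex \<Rightarrow>
    (fv, complex poly \<times> complex poly) super_module" where
  "Omega' \<rho> \<delta> lam a b = poly_module \<rho> \<delta> lam b
     (\<lambda>m. [:m * a, 1:])
     (\<lambda>m. [:- (3 * m / 2) + m * a, 1:])
     (\<lambda>r. [:- 2 * r * a + 3 * r, 1:])"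

definition Omega'' :: "(complex \<Rightarrow> complex) \<Rightarrow> complex \<Rightarrow> complex \<Rightarrow> complex \<Rightarrow>
    (fv, complex poly \<times> complex poly) super_module" where
  "Omega'' \<rho> \<delta> lam b = poly_module \<rho> \<delta> lam b
     (\<lambda>m. [:m, 1:])
     (\<lambda>m. [:- (3 / 2 * m), 1:])
     (\<lambda>r. [:3 * r, 1:] * [:r, 1:])"

definition Omega_tilde'' :: "(complex \<Rightarrow> complex) \<Rightarrow> complex \<Rightarrow> complex \<Rightarrow> complex \<Rightarrow>
    (fv, complex poly \<times> complex poly) super_module" where
  "Omega_tilde'' \<rho> \<delta> lam b = poly_module \<rho> \<delta> lam b
     (\<lambda>m. [:5 / 2 * m, 1:])
     (\<lambda>m. [:0, 1:])
     (\<lambda>r. [:0, 1:] * [:- 2 * r, 1:])"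

end

theory Submission
  imports Defs
begin

text \<open>
  On a free rank one \<open>\<complex>[L\<^sub>0]\<close>-module every homogeneous operator acts as
  \<open>f \<mapsto> q(x) f(x + wt)\<close>, so the module is a family of polynomials.
  For \<open>L\<^sub>m\<close> call it \<open>P\<^sub>m\<close>. The bracket of \<open>L\<^sub>m\<close> and \<open>L\<^sub>-\<^sub>m\<close> shows \<open>P\<^sub>m \<noteq> 0\<close> and
  that \<open>P\<^sub>-\<^sub>1(x) P\<^sub>1(x - 1)\<close> is a monic quadratic; a constant \<open>P\<^sub>1\<close> would make the
  degrees of \<open>P\<^sub>2, P\<^sub>3, \<dots>\<close> drop forever, so \<open>P\<^sub>1\<close> and \<open>P\<^sub>-\<^sub>1\<close> are linear, and brackets with them
  determine \<open>P\<^sub>m = \<lambda>\<^sup>m (x + m a)\<close>.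
  If \<open>\<psi>\<^sub>r\<close> vanishes on one parity for one \<open>r\<close>, then for all \<open>r\<close>; since \<open>\<psi>\<^sub>r\<^sup>2 = 0\<close> for \<open>r \<noteq> 0\<close>, it
  is zero on exactly one parity. On the other parity, leading coefficients in the bracket
  \<open>[L\<^sub>m, \<psi>\<^sub>r]\<close> force equal \<open>\<lambda>\<close>'s, a common degree \<open>d = a\<^sub>0 - a\<^sub>1 - 1/2\<close> and a common leading coefficient,
  and the case \<open>m = -2r\<close> then gives the polynomial
  \<open>b \<lambda>\<^sup>r \<Prod>\<^sub>j (x + r (1 - 2a\<^sub>0 + 2j))\<close>, \<open>1 \<le> j \<le> d\<close>, of \<open>\<psi>\<^sub>r\<close>.
  The remaining relations are polynomial in \<open>r\<close>, so one may put \<open>r = 0\<close>, \<open>x = 1\<close>; the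
  coefficients of \<open>m\<^sup>3\<close> and \<open>m\<^sup>4\<close> rule out \<open>d \<ge> 3\<close> and leave two values of \<open>a\<^sub>0\<close> for \<open>d = 2\<close>.
\<close>

section \<open>Translates of polynomials\<close>

lemma smult_cancel_left:
  fixes p q :: "'a::idom poly"
  shows "smult a p = smult a q \<longleftrightarrow> a = 0 \<or> p = q"
  using smult_eq_0_iff[of a "p - q"] by (simp add: smult_diff_right)

lemma poly_shift_poly [simp]: "poly (shift_poly c f) x = poly f (x + c)"
  by (simp add: shift_poly_def poly_pcompose add.commute)

lemma shift_poly_0 [simp]: "shift_poly c 0 = 0"
  by (simp add: shift_poly_def)

lemma shift_poly_pCons: "shift_poly c (pCons a f) = [:a:] + [:c, 1:] * shift_poly c f"
  by (simp add: shift_poly_def pcompose_pCons)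

lemma shift_poly_const [simp]: "shift_poly c [:a:] = [:a:]"
  by (simp add: shift_poly_def)

lemma shift_poly_1 [simp]: "shift_poly c 1 = 1"
  by (simp add: shift_poly_def pcompose_1)

lemma shift_poly_smult [simp]: "shift_poly c (smult a f) = smult a (shift_poly c f)"
  by (simp add: shift_poly_def pcompose_smult)

lemma shift_poly_diff: "shift_poly c (f - g) = shift_poly c f - shift_poly c g"
  by (simp add: shift_poly_def pcompose_diff)

lemma shift_poly_mult: "shift_poly c (f * g) = shift_poly c f * shift_poly c g"
  by (simp add: shift_poly_def pcompose_mult)

lemma shift_poly_prod: "shift_poly c (prod f A) = (\<Prod>i\<in>A. shift_poly c (f i))"
  by (simp add: shift_poly_def pcompose_prod)

lemma shift_poly_linear: "shift_poly c [:a, b:] = [:a + b * c, b:]"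
  by (simp add: shift_poly_def pcompose_pCons)

lemma shift_poly_zero [simp]: "shift_poly 0 f = f"
  by (rule poly_ext) simp

lemma degree_shift_poly [simp]: "degree (shift_poly c f) = degree f"
  by (simp add: shift_poly_def degree_pcompose)

lemma lead_coeff_shift_poly: "coeff (shift_poly c f) (degree f) = lead_coeff f"
  using lead_coeff_comp[of "[:c, 1:]" f] by (simp add: shift_poly_def degree_pcompose)

lemma shift_poly_eq_0_iff [simp]: "shift_poly c f = 0 \<longleftrightarrow> f = 0"
  by (metis degree_0 degree_shift_poly lead_coeff_shift_poly leading_coeff_0_iff shift_poly_0)

lemma coeff_shift_poly_subleading:
  assumes "degree f \<le> Suc n"
  shows "coeff (shift_poly c f) n = coeff f n + of_nat (Suc n) * c * coeff f (Suc n)"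
  using assms
proof (induction n arbitrary: f)
  case 0
  obtain a b where "f = [:a, b:]"
    using 0 degree1_coeffs[of f] degree_eq_zeroE[of f]
    by (metis One_nat_def le_Suc_eq le_zero_eq pCons_0_0)
  then show ?case by (simp add: shift_poly_linear mult.commute)
next
  case (Suc n)
  obtain a g where f: "f = pCons a g" by (cases f) auto
  have g: "degree g \<le> Suc n" using Suc.prems f by (cases "g = 0") auto
  have "coeff (shift_poly c g) (Suc n) = coeff g (Suc n)"
    using g lead_coeff_shift_poly[of c g]
    by (metis coeff_eq_0 degree_shift_poly le_neq_implies_less)
  then show ?case using Suc.IH[OF g] by (simp add: f shift_poly_pCons algebra_simps)
qed

text \<open>The terms of degree \<open>degree f + 1\<close> cancel because \<open>f\<close> and its
  translate share the leading coefficient; one place lower the translate adds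
  \<open>degree f * c\<close> times it.\<close>

lemma linear_shift_diff:
  fixes u v c :: complex and f :: "complex poly"
  defines "G \<equiv> [:u, 1:] * shift_poly c f - [:v, 1:] * f"
  shows "degree G \<le> degree f"
    and "coeff G (degree f) = lead_coeff f * (u - v + of_nat (degree f) * c)"
proof -
  have top: "coeff (shift_poly c f) (degree f) = lead_coeff f" by (rule lead_coeff_shift_poly)
  have big: "coeff (shift_poly c f) k = 0" "coeff f k = 0" if "k > degree f" for k
    using that by (simp_all add: coeff_eq_0)
  show "degree G \<le> degree f"
  proof (rule degree_le, intro allI impI)
    fix k assume k: "degree f < k"
    then obtain n where "k = Suc n" by (cases k) auto
    then show "coeff G k = 0"
      using k big top by (cases "n = degree f") (auto simp: G_def)
  qed
  show "coeff G (degree f) = lead_coeff f * (u - v + of_nat (degree f) * c)"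
  proof (cases "degree f")
    case 0
    then show ?thesis using top by (simp add: G_def algebra_simps)
  next
    case (Suc n)
    then show ?thesis using top coeff_shift_poly_subleading[of f n c]
      by (simp add: G_def algebra_simps)
  qed
qed

text \<open>Serves uniqueness: such an equation prescribes the degree of its nonzero solutions, so a
  difference of solutions with any other degree is 0.\<close>

lemma linear_shift_eqD:
  assumes "[:u, 1:] * shift_poly c f = [:v, 1:] * f" and "f \<noteq> 0"
  shows "u - v + of_nat (degree f) * c = 0"
  using linear_shift_diff(2)[of u c f v] assms(2) unfolding assms(1) by simp

lemma periodic_poly_constant:
  assumes "shift_poly c f = f" "c \<noteq> 0" shows "degree f = 0"
proof (rule ccontr)
  assume "degree f \<noteq> 0"
  then obtain n where n: "degree f = Suc n" by (cases "degree f") auto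
  then show False using coeff_shift_poly_subleading[of f n c] assms
    by (simp add: of_nat_eq_0_iff del: of_nat_Suc) (metis degree_0 leading_coeff_0_iff nat.distinct(1))
qed

section \<open>Virasoro modules of rank one\<close>

text \<open>\<open>P m\<close> and \<open>C\<close> stand for \<open>L_m 1\<close> and
  \<open>c 1\<close> on \<open>\<complex>[x]\<close>, where \<open>L_0\<close> is multiplication by
  \<open>x\<close>; the relations are the brackets \<open>[L_m, L_n]\<close> and
  \<open>[L_m, c] = 0\<close> applied to \<open>1\<close>.\<close>

locale virasoro_polys =
  fixes P :: "int \<Rightarrow> complex poly" and C :: "complex poly"
  assumes P_0: "P 0 = [:0, 1:]"
    and vir: "P m * shift_poly (of_int m) (P n) - P n * shift_poly (of_int n) (P m) =
      smult (of_int (m - n)) (P (m + n)) +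
      (if m = - n then smult (of_int (m ^ 3 - m) / 12) C else 0)"
    and vir_C: "P m * shift_poly (of_int m) C = C * P m"
begin

lemma C_periodic: "P m \<noteq> 0 \<Longrightarrow> shift_poly (of_int m) C = C"
  using vir_C[of m] by (metis mult.commute mult_cancel_left)

text \<open>Since \<open>e ^ 3 = e\<close>, the central term is absent, and the product
  \<open>Q\<close> satisfies \<open>Q(x + e) - Q(x) = 2 e x\<close>. One solution is
  \<open>x^2 - e x\<close>; any other differs from it by a periodic polynomial, that is, a
  constant.\<close>

lemma unit_product:
  assumes "e = 1 \<or> e = -1"
  obtains c where "P (-e) * shift_poly (of_int (-e)) (P e) = [:c, - of_int e, 1:]"
proof -
  define Q where "Q = P (-e) * shift_poly (of_int (-e)) (P e)"
  have "shift_poly (of_int e) Q - Q = [:0, 2 * of_int e:]"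
  proof -
    have "shift_poly (of_int e) Q = P e * shift_poly (of_int e) (P (-e))"
      unfolding Q_def by (simp add: poly_eq_poly_eq_iff[symmetric] fun_eq_iff shift_poly_mult)
    moreover have "(of_int (e ^ 3 - e) :: complex) = 0" using assms by auto
    ultimately show ?thesis
      using vir[of e "-e"] unfolding Q_def by (simp add: P_0)
  qed
  then have "shift_poly (of_int e) (Q - [:0, - of_int e, 1:]) = Q - [:0, - of_int e, 1:]"
    using assms by (auto simp: shift_poly_diff shift_poly_pCons algebra_simps)
  then have "degree (Q - [:0, - of_int e, 1:]) = 0"
    by (rule periodic_poly_constant) (use assms in auto)
  then obtain c where "Q - [:0, - of_int e, 1:] = [:c:]" using degree_eq_zeroE by blast
  then have "Q = [:c, - of_int e, 1:]" by (simp add: algebra_simps)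
  then show ?thesis using that[of c] Q_def by simp
qed

lemma P_unit_nonzero: assumes "e = 1 \<or> e = -1" shows "P e \<noteq> 0"
  by (rule unit_product[OF assms]) auto

lemma C_constant: "degree C = 0"
  using periodic_poly_constant[OF C_periodic[OF P_unit_nonzero[of 1]]] by simp

text \<open>Both products in the bracket of \<open>L_m\<close> with \<open>L_{-m}\<close> contain
  \<open>P m\<close>, while the other side has linear coefficient \<open>2 m\<close>.\<close>

lemma P_nonzero: "P m \<noteq> 0"
proof
  assume 0: "P m = 0"
  then have m: "m \<noteq> 0" using P_0 by auto
  obtain c where c: "C = [:c:]" using C_constant degree_eq_zeroE by blast
  have "smult (of_int (2 * m)) [:0, 1:] + smult (of_int (m ^ 3 - m) / 12) [:c:] = 0"
    using vir[of m "-m"] 0 by (simp add: P_0 c)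
  then have "coeff (smult (of_int (2 * m)) [:0, 1:] + smult (of_int (m ^ 3 - m) / 12) [:c:]) 1 = (0::complex)"
    by (simp only: coeff_0)
  then show False using m by simp
qed

lemma P_unit_not_constant:
  assumes e: "e = 1 \<or> e = -1" shows "degree (P e) \<noteq> 0"
proof
  assume "degree (P e) = 0"
  then obtain a where a: "P e = [:a:]" using degree_eq_zeroE by blast
  have step: "smult (of_int (e * (1 - int n))) (P (e * (int n + 1))) =
      smult a (shift_poly (of_int e) (P (e * int n)) - P (e * int n))" if "n \<noteq> 0" for n
    using vir[of e "e * int n"] e that by (auto simp: a algebra_simps smult_diff_right)
  \<comment> \<open>The bound 2 matters: for \<open>n = 1\<close> the factor \<open>1 - n\<close>
    vanishes and the bracket says nothing about \<open>P (e * 2)\<close>.\<close>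
  have drop: "degree (P (e * (int n + 1))) < degree (P (e * int n))" if "n \<ge> 2" for n
  proof -
    let ?f = "P (e * int n)"
    define G where "G = shift_poly (of_int e) ?f - ?f"
    have eq: "smult (of_int (e * (1 - int n))) (P (e * (int n + 1))) = smult a G"
      using step[of n] that unfolding G_def by simp
    have "G \<noteq> 0" using eq P_nonzero[of "e * (int n + 1)"] e that by auto
    have "coeff G (degree ?f) = 0" unfolding G_def by (simp add: lead_coeff_shift_poly)
    moreover have "degree G \<le> degree ?f" unfolding G_def by (simp add: degree_diff_le)
    ultimately have "degree G < degree ?f"
      using \<open>G \<noteq> 0\<close> by (metis le_neq_implies_less leading_coeff_0_iff)
    moreover have "a \<noteq> 0" using P_nonzero[of e] a by auto
    ultimately show ?thesis using arg_cong[OF eq, of degree] e that by auto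
  qed
  have "degree (P (e * int (n + 2))) + n \<le> degree (P (e * 2))" for n
  proof (induction n)
    case (Suc n)
    then show ?case using drop[of "n + 2"] by (simp add: algebra_simps)
  qed simp
  from this[of "Suc (degree (P (e * 2)))"] show False by simp
qed

lemma P_unit_linear:
  obtains lam a where "lam \<noteq> 0" "P 1 = smult lam [:a, 1:]" "P (-1) = smult (inverse lam) [:- a, 1:]"
proof -
  obtain c where c: "P (-1) * shift_poly (-1) (P 1) = [:c, -1, 1:]"
    using unit_product[of 1] by auto
  have "degree (P (-1)) + degree (P 1) = 2"
    using arg_cong[OF c, of degree] P_nonzero by (simp add: degree_mult_eq)
  then have "degree (P 1) = 1" "degree (P (-1)) = 1"
    using P_unit_not_constant[of 1] P_unit_not_constant[of "-1"] by simp_all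
  then obtain p0 p1 q0 q1 where p: "P 1 = [:p0, p1:]" "p1 \<noteq> 0" and q: "P (-1) = [:q0, q1:]"
    by (metis degree1_coeffs)
  \<comment> \<open>The shift by \<open>-1\<close> makes the coefficient of \<open>x\<close> equal
    to \<open>q0 * p1 + q1 * p0 - q1 * p1\<close>, and this has to be \<open>-1\<close>.\<close>
  have 1: "q1 * p1 = 1" "q0 * p1 + q1 * p0 = 0"
    using c by (auto simp: p q shift_poly_linear algebra_simps)
  then have "q1 = inverse p1" by (metis inverse_unique mult.commute)
  moreover have "q0 = - p0 / (p1 * p1)"
    using 1 p(2) calculation by (simp add: field_simps add_eq_0_iff)
  ultimately show ?thesis
    using p q by (intro that[of p1 "p0 / p1"]) (auto simp: field_simps)
qed

text \<open>The induction uses the lowering bracket with \<open>L_{-e}\<close>, because raising by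
  \<open>L_e\<close> cannot reach \<open>L_{2e}\<close> from \<open>L_e\<close>. It is an
  inhomogeneous equation for the next polynomial; the claimed one solves it, and the homogeneous
  equation has only the solution 0.\<close>

lemma P_multiple:
  assumes e: "e = 1 \<or> e = -1" and lam: "lam \<noteq> 0"
    and P_e: "P (-e) = smult (inverse lam) [:- of_int e * a, 1:]"
  shows "P (e * int n) = smult (lam ^ n) [:of_int (e * int n) * a, 1:]"
proof (induction n)
  case (Suc n)
  let ?m = "e * int (Suc n)"
  define F where "F = smult (lam ^ Suc n) [:of_int ?m * a, 1:]"
  \<comment> \<open>Up to the factor \<open>inverse lam\<close>, this is the commutator of
    \<open>L_{-e}\<close> with an operator of weight \<open>?m\<close> and polynomial
    \<open>f\<close>.\<close>
  let ?op = "\<lambda>f. [:- of_int e * a, 1:] * shift_poly (of_int (-e)) f -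
    [:of_int ?m - of_int e * a, 1:] * f"
  have "P (-e) * shift_poly (of_int (-e)) (P ?m) - P ?m * shift_poly (of_int ?m) (P (-e)) =
      smult (of_int (-e - ?m)) (P (e * int n))"
    using vir[of "-e" ?m] e by (auto simp: algebra_simps)
  then have op_P: "smult (inverse lam) (?op (P ?m)) = smult (of_int (-e - ?m)) (P (e * int n))"
    unfolding P_e by (simp add: shift_poly_linear smult_diff_right smult_add_right mult.commute[of _ "[:_, _:]"]
      right_diff_distrib)
  have op_F: "smult (inverse lam) (?op F) = smult (of_int (-e - ?m)) (P (e * int n))"
    using e lam unfolding Suc.IH F_def poly_eq_poly_eq_iff[symmetric] fun_eq_iff
    by (auto simp: field_simps)
  have "?op (P ?m - F) = ?op (P ?m) - ?op F"
    by (simp add: shift_poly_diff algebra_simps smult_diff_right)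
  also have "\<dots> = 0" using op_P op_F lam by (metis right_minus_eq smult_cancel_left inverse_nonzero_iff_nonzero)
  finally have "[:- of_int e * a, 1:] * shift_poly (of_int (-e)) (P ?m - F) =
    [:of_int ?m - of_int e * a, 1:] * (P ?m - F)" by (simp only: right_minus_eq)
  \<comment> \<open>A nonzero solution of degree \<open>k\<close> would force
    \<open>n + 1 + k = 0\<close>.\<close>
  moreover have "- of_int e * a - (of_int ?m - of_int e * a) + of_nat k * of_int (- e) \<noteq> 0" for k
  proof -
    have "- of_int e * a - (of_int ?m - of_int e * a) + of_nat k * of_int (- e) =
      - of_int e * (of_nat (Suc (n + k)) :: complex)" by (simp add: algebra_simps)
    then show ?thesis using e by (metis mult_eq_0_iff neg_equal_0_iff_equal of_int_eq_0_iff of_nat_eq_0_iff nat.distinct(1) zero_neq_neg_one zero_neq_one)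
  qed
  ultimately have "P ?m - F = 0" using linear_shift_eqD by blast
  then show ?case by (simp add: F_def)
qed (simp add: P_0)

theorem classification:
  obtains lam a where "lam \<noteq> 0" "\<And>m. P m = smult (lam powi m) [:of_int m * a, 1:]" "C = 0"
proof -
  obtain lam a where lam: "lam \<noteq> 0" and P1: "P 1 = smult lam [:a, 1:]"
    and P_1: "P (-1) = smult (inverse lam) [:- a, 1:]" by (rule P_unit_linear)
  have P: "P m = smult (lam powi m) [:of_int m * a, 1:]" for m
  proof (cases "m \<ge> 0")
    case True
    then obtain n where "m = int n" by (metis nonneg_int_cases)
    then show ?thesis using P_multiple[of 1 lam a n] lam P_1 by (simp add: power_int_def)
  next
    case False
    then obtain n where "m = - int n" by (metis int_cases2 linorder_not_le nle_le of_nat_0_le_iff)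
    then show ?thesis using P_multiple[of "-1" "inverse lam" a n] lam P1
      by (simp add: power_int_minus power_inverse)
  qed
  \<comment> \<open>The index 2 is the first positive one with a central term:
    \<open>m ^ 3 - m = 6\<close> gives \<open>C / 2\<close>. The explicit polynomials already
    account for all of \<open>4 L_0\<close>.\<close>
  have "P 2 * shift_poly 2 (P (-2)) - P (-2) * shift_poly (-2) (P 2) = [:0, 4:]"
    using lam by (simp add: P shift_poly_linear power_int_minus power_inverse algebra_simps)
  then have "smult (1/2) C = 0" using vir[of 2 "-2"] by (simp add: P_0)
  then have "C = 0" by simp
  with lam P that show ?thesis by blast
qed

end

section \<open>The polynomials of the odd generators\<close>

text \<open>The roots form an arithmetic progression of difference \<open>2 r\<close>, up to sign.
  With \<open>A = 1 - 2 * a0\<close>, zero, one or two factors give the polynomials of the four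
  families.\<close>

definition ladder_poly :: "complex \<Rightarrow> nat \<Rightarrow> complex \<Rightarrow> complex poly" where
  "ladder_poly A d r = (\<Prod>j<d. [:r * (A + 2 * of_nat (Suc j)), 1:])"

lemma monic_ladder: "degree (ladder_poly A d r) = d" "lead_coeff (ladder_poly A d r) = 1"
proof -
  show deg: "degree (ladder_poly A d r) = d"
    unfolding ladder_poly_def by (simp add: degree_prod_eq_sum_degree)
  show "lead_coeff (ladder_poly A d r) = 1"
    unfolding ladder_poly_def lead_coeff_prod by simp
qed

lemma poly_ladder: "poly (ladder_poly A d r) x = (\<Prod>j<d. x + r * (A + 2 * of_nat (Suc j)))"
  by (simp add: ladder_poly_def poly_prod add.commute)

text \<open>Translation by \<open>-2 r\<close> lowers the index of each factor by one, so the two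
  products differ only in their end factors. This is the relation of \<open>[L_m, psi_r]\<close> for
  \<open>m = -2 r\<close>, where the right side vanishes.\<close>

lemma ladder_reflection:
  "[:r * (A + 2 * of_nat d), 1:] * shift_poly (- 2 * r) (ladder_poly A d r) =
    [:r * A, 1:] * ladder_poly A d r"
proof -
  define c where "c j = [:r * (A + 2 * of_nat j), 1:]" for j :: nat
  have "shift_poly (- 2 * r) (ladder_poly A d r) = (\<Prod>j<d. c j)"
    unfolding ladder_poly_def c_def
    by (simp add: shift_poly_prod shift_poly_linear algebra_simps)
  moreover have "ladder_poly A d r = (\<Prod>j<d. c (Suc j))" by (simp add: ladder_poly_def c_def)
  moreover have "c d * (\<Prod>j<d. c j) = c 0 * (\<Prod>j<d. c (Suc j))"
    using prod.lessThan_Suc_shift[of c d] prod.lessThan_Suc[of c d] by (simp add: mult.commute)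
  ultimately show ?thesis by (simp add: c_def)
qed

text \<open>\<open>S k\<close> describes \<open>psi_r\<close> for \<open>r = r k\<close>, freed of
  the power of \<lambda>; \<open>a0\<close> and \<open>a1\<close> belong to \<open>L_m\<close> on
  its source and target. The summand \<open>r k\<close> arises when \<open>psi_r\<close> is moved
  past \<open>L_m\<close>.\<close>

locale odd_polys =
  fixes \<delta> a0 a1 :: complex and S :: "int \<Rightarrow> complex poly" and r :: "int \<Rightarrow> complex"
  defines "r k \<equiv> of_int k + \<delta>"
  assumes delta: "\<delta> = 0 \<or> \<delta> = 1 / 2"
    and nonzero: "S k \<noteq> 0"
    and odd_rel: "[:of_int m * a1, 1:] * shift_poly (of_int m) (S k) -
      [:r k + of_int m * a0, 1:] * S k = smult (- (r k + of_int m / 2)) (S (m + k))"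
begin

text \<open>In terms of the target index \<open>l\<close>, the scalar on the right vanishes exactly
  for opposite \<open>r k\<close> and \<open>r l\<close>, the case that governs the reflection
  argument.\<close>

lemma rel': "[:(r l - r k) * a1, 1:] * shift_poly (r l - r k) (S k) -
      [:r k + (r l - r k) * a0, 1:] * S k = smult (- (r k + r l) / 2) (S l)"
proof -
  have "- (r k + of_int (l - k) / 2) = - (r k + r l) / 2" by (simp add: r_def field_simps)
  moreover have "of_int (l - k) = r l - r k" by (simp add: r_def)
  ultimately show ?thesis using odd_rel[of "l - k" k] by (simp only: diff_add_cancel)
qed

lemma r_inj: "r k = r l \<longleftrightarrow> k = l" by (simp add: r_def)

lemma infinite_r: "infinite (range r - {x, y})"
proof -
  have "infinite (range r)"
    using finite_imageD[of r UNIV] r_inj by (auto simp: inj_def infinite_UNIV_int)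
  then show ?thesis by (simp add: insert_Diff_if)
qed

lemma ex_r: "\<exists>k. r k \<noteq> x \<and> r k \<noteq> y"
proof -
  have "range r - {x, y} \<noteq> {}" using infinite_r[of x y] by (metis finite.emptyI)
  then show ?thesis by blast
qed

definition d where "d = degree (S 0)"
definition b where "b = lead_coeff (S 0)"

lemma leading:
  "lead_coeff (S k) * ((r l - r k) * (a1 - a0 + of_nat (degree (S k))) - r k) =
    - (r k + r l) / 2 * coeff (S l) (degree (S k))"
  using linear_shift_diff(2)[of "(r l - r k) * a1" "r l - r k" "S k" "r k + (r l - r k) * a0"]
  unfolding rel' coeff_smult by (simp only: algebra_simps)

lemma degree_le': assumes "r l \<noteq> - r k" shows "degree (S l) \<le> degree (S k)"
  using linear_shift_diff(1)[of "(r l - r k) * a1" "r l - r k" "S k" "r k + (r l - r k) * a0"] assms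
  unfolding rel' by (auto simp: add_eq_0_iff)

text \<open>Only opposite indices escape \<open>degree_le'\<close>, so two arbitrary indices are
  compared through a third one, opposite to neither.\<close>

lemma degree_S: "degree (S k) = d"
proof -
  have "degree (S k) \<le> degree (S l)" for k l
  proof -
    obtain j where "r j \<noteq> - r k" "r j \<noteq> - r l" using ex_r by blast
    then have "r j \<noteq> - r l" "r k \<noteq> - r j" by auto
    then show ?thesis using degree_le' order_trans by blast
  qed
  then show ?thesis unfolding d_def by (simp add: order_antisym)
qed

lemma d_eq: "of_nat d = a0 - a1 - 1 / 2"
proof -
  obtain k where k: "r k \<noteq> 0" using ex_r by blast
  \<comment> \<open>The index of \<open>- r k\<close>: for half-integers,
    \<open>-(k + 1/2) = (-k - 1) + 1/2\<close>.\<close>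
  define l :: int where "l = (if \<delta> = 0 then - k else - k - 1)"
  have l: "r l = - r k" using delta by (auto simp: r_def l_def field_simps)
  have "lead_coeff (S k) * (- r k * (2 * (a1 - a0 + of_nat d) + 1)) = 0"
    using leading[of k l] unfolding l degree_S by (simp add: algebra_simps)
  then have "2 * (a1 - a0 + of_nat d) + 1 = 0" using k nonzero[of k] by simp
  then show ?thesis by (simp add: field_simps)
qed

lemma lead_coeff_S: "lead_coeff (S k) = b"
proof -
  have *: "lead_coeff (S k) = lead_coeff (S l)" if "r l \<noteq> - r k" for k l
  proof -
    have "- (r k + r l) / 2 * lead_coeff (S k) = - (r k + r l) / 2 * lead_coeff (S l)"
      using leading[of k l] unfolding degree_S d_eq
      by (simp add: field_simps)
    moreover have "- (r k + r l) / 2 \<noteq> 0" using that by (auto simp: add_eq_0_iff)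
    ultimately show ?thesis using mult_cancel_left by blast
  qed
  obtain j where "r j \<noteq> - r k" "r j \<noteq> - r 0" using ex_r by blast
  then have "r k \<noteq> - r j" "r j \<noteq> - r 0" by auto
  then have "lead_coeff (S j) = lead_coeff (S k)" "lead_coeff (S 0) = lead_coeff (S j)"
    using * by blast+
  then show ?thesis unfolding b_def by simp
qed

lemma b_nonzero: "b \<noteq> 0" using nonzero[of 0] by (simp add: b_def)

text \<open>Chosen so that \<open>m = -2 r\<close> turns the constant terms of the relation into
  \<open>r * (A + 2 d)\<close> and \<open>r * A\<close>, the two ends of the ladder.\<close>

definition A where "A = 1 - 2 * a0"

lemma a0: "a0 = (1 - A) / 2" by (simp add: A_def)

lemma a1: "a1 = - A / 2 - of_nat d" by (simp add: A_def d_eq field_simps)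

text \<open>\<open>S k\<close> and the ladder solve the same homogeneous equation with equal degree
  and leading coefficient; a nonzero difference of degree \<open>e < d\<close> would need
  \<open>2 r (d - e) = 0\<close>. For \<open>r = 0\<close> the reflection is \<open>m = 0\<close>
  and yields nothing.\<close>

lemma S_ladder: assumes "r k \<noteq> 0" shows "S k = smult b (ladder_poly A d (r k))"
proof (rule ccontr)
  define G where "G = S k - smult b (ladder_poly A d (r k))"
  assume "\<not> ?thesis"
  then have G: "G \<noteq> 0" by (simp add: G_def)
  have "coeff G d = 0"
    using monic_ladder[of A d "r k"] lead_coeff_S[of k] by (simp add: G_def degree_S)
  moreover have "degree G \<le> d"
    unfolding G_def by (rule degree_diff_le) (simp_all add: degree_S monic_ladder b_nonzero)
  ultimately have deg: "degree G < d" using G leading_coeff_0_iff[of G] by (cases "degree G = d") auto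
  define l :: int where "l = (if \<delta> = 0 then - k else - k - 1)"
  have l: "r l = - r k" using delta by (auto simp: r_def l_def field_simps)
  have eqs: "(r l - r k) * a1 = r k * (A + 2 * of_nat d)" "r k + (r l - r k) * a0 = r k * A"
    "r l - r k = - 2 * r k"
    by (simp_all add: l A_def d_eq field_simps)
  have "[:r k * (A + 2 * of_nat d), 1:] * shift_poly (- 2 * r k) (S k) = [:r k * A, 1:] * S k"
    using rel'[of l k] unfolding eqs(1,2) unfolding eqs(3) by (simp add: l)
  then have "[:r k * (A + 2 * of_nat d), 1:] * shift_poly (- 2 * r k) G = [:r k * A, 1:] * G"
    using ladder_reflection[of "r k" A d] unfolding G_def
    by (simp only: shift_poly_diff shift_poly_smult right_diff_distrib mult_smult_right)
  from linear_shift_eqD[OF this G] have "r k * (of_nat d - of_nat (degree G)) = 0"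
    by (simp add: algebra_simps)
  then show False using deg assms by simp
qed

text \<open>For fixed \<open>m\<close> and \<open>x\<close> both sides are polynomials in
  \<open>t\<close> that agree at all but at most two of the values \<open>r k\<close>, hence
  everywhere. This makes \<open>t = 0\<close> available for both values of \<delta>.\<close>

lemma ladder_identity:
  "[:of_int m * a1, 1:] * shift_poly (of_int m) (ladder_poly A d t) -
    [:t + of_int m * a0, 1:] * ladder_poly A d t =
    smult (- (t + of_int m / 2)) (ladder_poly A d (t + of_int m))"
proof -
  have "poly ([:of_int m * a1, 1:] * shift_poly (of_int m) (ladder_poly A d t) -
      [:t + of_int m * a0, 1:] * ladder_poly A d t) x =
    poly (smult (- (t + of_int m / 2)) (ladder_poly A d (t + of_int m))) x" for x
  proof -
    let ?c = "\<lambda>j. A + 2 * of_nat (Suc j)"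
    \<comment> \<open>A polynomial in \<open>t\<close>, with \<open>x\<close> a constant in its
      coefficients.\<close>
    define F where "F = smult (of_int m * a1 + x) (\<Prod>j<d. [:x + of_int m, ?c j:]) -
        [:of_int m * a0 + x, 1:] * (\<Prod>j<d. [:x, ?c j:]) +
        [:of_int m / 2, 1:] * (\<Prod>j<d. [:x + of_int m * ?c j, ?c j:])"
    have F: "poly F t = poly ([:of_int m * a1, 1:] * shift_poly (of_int m) (ladder_poly A d t) -
      [:t + of_int m * a0, 1:] * ladder_poly A d t) x -
      poly (smult (- (t + of_int m / 2)) (ladder_poly A d (t + of_int m))) x" for t
    proof -
      have "(\<Prod>j<d. x + of_int m + t * ?c j) = poly (ladder_poly A d t) (x + of_int m)"
        "(\<Prod>j<d. x + t * ?c j) = poly (ladder_poly A d t) x"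
        "(\<Prod>j<d. x + of_int m * ?c j + t * ?c j) = poly (ladder_poly A d (t + of_int m)) x"
        unfolding poly_ladder by (simp_all add: add.commute add.left_commute distrib_right)
      then show ?thesis
        unfolding F_def
        by (simp add: poly_prod add.commute del: of_nat_Suc) (simp add: algebra_simps)
    qed
    \<comment> \<open>At the two excluded points \<open>r k\<close> or \<open>r (m + k)\<close> is
      0, out of reach of \<open>S_ladder\<close>.\<close>
    have "poly F t = 0" if t: "t \<in> range r - {0, - of_int m}" for t
    proof -
      obtain k where k: "t = r k" "r k \<noteq> 0" "r k \<noteq> - of_int m" using t by blast
      have mk: "r (m + k) = r k + of_int m" by (simp add: r_def)
      then have "r (m + k) \<noteq> 0" using k by (simp add: add_eq_0_iff2)
      have "smult b ([:of_int m * a1, 1:] * shift_poly (of_int m) (ladder_poly A d t) -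
          [:t + of_int m * a0, 1:] * ladder_poly A d t) =
        smult b (smult (- (t + of_int m / 2)) (ladder_poly A d (t + of_int m)))"
        using odd_rel[of m k]
        unfolding S_ladder[OF k(2)] S_ladder[OF \<open>r (m + k) \<noteq> 0\<close>] mk k(1)
        by (simp only: shift_poly_smult smult_diff_right mult_smult_right smult_smult
            mult.commute[of b "- (r k + of_int m / 2)"])
      then have "[:of_int m * a1, 1:] * shift_poly (of_int m) (ladder_poly A d t) -
          [:t + of_int m * a0, 1:] * ladder_poly A d t =
        smult (- (t + of_int m / 2)) (ladder_poly A d (t + of_int m))"
        using b_nonzero smult_cancel_left by blast
      then show ?thesis unfolding F by simp
    qed
    then have "range r - {0, - of_int m} \<subseteq> {t. poly F t = 0}" by blast
    then have "infinite {t. poly F t = 0}" using infinite_r infinite_super by blast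
    then have "F = 0" using poly_roots_finite by blast
    then show ?thesis using F[of t] by simp
  qed
  then show ?thesis by (intro poly_ext)
qed

text \<open>To cover \<open>r k = 0\<close> too, \<open>S k\<close> is computed from an index
  \<open>l\<close> with \<open>r l\<close> nonzero and not opposite to \<open>r k\<close>, so that
  the scalar in front of \<open>S k\<close> can be cancelled.\<close>

lemma S_eq: "S k = smult b (ladder_poly A d (r k))"
proof -
  obtain l where l: "r l \<noteq> 0" "r l \<noteq> - r k" using ex_r by blast
  define m where "m = k - l"
  have m: "m + l = k" "r l + of_int m = r k" by (simp_all add: m_def r_def)
  have "smult (- (r l + of_int m / 2)) (S k) = smult b
      ([:of_int m * a1, 1:] * shift_poly (of_int m) (ladder_poly A d (r l)) -
        [:r l + of_int m * a0, 1:] * ladder_poly A d (r l))"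
    using odd_rel[of m l] unfolding S_ladder[OF l(1)] m
    by (simp only: shift_poly_smult mult_smult_right smult_diff_right)
  also have "\<dots> = smult (- (r l + of_int m / 2)) (smult b (ladder_poly A d (r k)))"
    unfolding ladder_identity m by (simp only: smult_smult mult.commute[of b "- (r l + of_int m / 2)"])
  finally have "smult (- (r l + of_int m / 2)) (S k) =
    smult (- (r l + of_int m / 2)) (smult b (ladder_poly A d (r k)))" .
  moreover have "r l + of_int m / 2 \<noteq> 0"
  proof -
    have "2 * (r l + of_int m / 2) = r l + r k" by (simp add: m_def r_def field_simps)
    then show ?thesis using l(2) by (metis add_eq_0_iff add.commute mult_zero_right)
  qed
  ultimately show ?thesis unfolding smult_cancel_left neg_equal_0_iff_equal by blast
qed

end

section \<open>Comparison of coefficients and the bound on the number of factors\<close>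

lemma coeff_binomial_power:
  fixes d :: nat
  shows "coeff ([:1, 1:] ^ d) 0 = (1::complex)"
    and "coeff ([:1, 1:] ^ d) (Suc 0) = (of_nat d :: complex)"
    and "coeff ([:1, 1:] ^ d) 2 = (of_nat d * (of_nat d - 1) / 2 :: complex)"
    and "coeff ([:1, 1:] ^ d) 3 = (of_nat d * (of_nat d - 1) * (of_nat d - 2) / 6 :: complex)"
    and "coeff ([:1, 1:] ^ d) 4 =
      (of_nat d * (of_nat d - 1) * (of_nat d - 2) * (of_nat d - 3) / 24 :: complex)"
  by (induction d) (simp_all add: numeral_eq_Suc, simp_all add: field_simps, algebra+)

text \<open>These are elementary symmetric functions of \<open>A + 2, ..., A + 2 d\<close>;
  \<open>h\<close> is the mean of these numbers, and centring there keeps the formulas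
  short.\<close>

lemma coeff_ladder_product:
  fixes A :: complex and d :: nat
  defines "Q \<equiv> \<Prod>j<d. [:1, A + 2 * of_nat (Suc j):]" and "h \<equiv> A + of_nat d + 1"
  shows "coeff Q 0 = 1"
    and "coeff Q (Suc 0) = of_nat d * h"
    and "coeff Q 2 = of_nat d * (of_nat d - 1) / 2 * h ^ 2 - of_nat d * (of_nat d ^ 2 - 1) / 6"
    and "coeff Q 3 = of_nat d * (of_nat d - 1) * (of_nat d - 2) / 6 * h ^ 3 -
      h * (of_nat d - 2) * of_nat d * (of_nat d ^ 2 - 1) / 6"
  unfolding Q_def h_def
  by (induction d) (simp_all add: numeral_eq_Suc, simp_all add: field_simps)

context odd_polys
begin

text \<open>\<open>ladder_identity\<close> at \<open>t = 0\<close>, \<open>x = 1\<close>, where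
  every ladder becomes explicit; valid for all integers \<open>m\<close>, it holds as an identity of
  polynomials in \<open>m\<close>.\<close>

lemma product_identity:
  "[:1, a1:] * [:1, 1:] ^ d - [:1, a0:] =
    smult (- 1 / 2) ([:0, 1:] * (\<Prod>j<d. [:1, A + 2 * of_nat (Suc j):]))"
proof -
  let ?F = "[:1, a1:] * [:1, 1:] ^ d - [:1, a0:] -
    smult (- 1 / 2) ([:0, 1:] * (\<Prod>j<d. [:1, A + 2 * of_nat (Suc j):]))"
  have "poly ?F (of_int m) = 0" for m
    using arg_cong[OF ladder_identity[of m 0], of "\<lambda>p. poly p 1"]
    by (simp add: poly_ladder poly_prod algebra_simps)
  then have "range (of_int :: int \<Rightarrow> complex) \<subseteq> {x. poly ?F x = 0}" by blast
  moreover have "infinite (range (of_int :: int \<Rightarrow> complex))"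
    using finite_imageD[of "of_int :: int \<Rightarrow> complex" UNIV] by (auto simp: inj_def infinite_UNIV_int)
  ultimately have "?F = 0" using poly_roots_finite infinite_super by blast
  then show ?thesis by simp
qed

lemma ladder_parameters:
  "d = 0 \<or> d = 1 \<or> d = 2 \<and> (A = - 1 \<or> A = - 4)"
proof (cases "d \<ge> 2")
  case False
  then show ?thesis by auto
next
  case d: True
  define h n where "h = A + of_nat d + 1" and "n = (of_nat d :: complex)"
  have a1': "a1 = - (h + n - 1) / 2" by (simp add: a1 h_def n_def field_simps)
  have n: "n \<noteq> 0" "n - 1 \<noteq> 0" using d by (auto simp: n_def)
  let ?Q = "\<Prod>j<d. [:1, A + 2 * of_nat (Suc j):]"
  note coeffs = coeff_binomial_power coeff_ladder_product[where d = d and A = A, folded h_def]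
  have c3: "n * (n - 1) * (n - 2) / 6 + a1 * (n * (n - 1) / 2) =
      - (n * (n - 1) / 2 * h ^ 2 - n * (n ^ 2 - 1) / 6) / 2"
  proof -
    have "coeff ([:1, 1:] ^ d) 3 + a1 * coeff ([:1, 1:] ^ d) 2 = - coeff ?Q 2 / 2"
      using arg_cong[OF product_identity, of "\<lambda>p. coeff p 3"] by (simp add: numeral_eq_Suc)
    then show ?thesis unfolding coeffs n_def .
  qed
  have c4: "n * (n - 1) * (n - 2) * (n - 3) / 24 + a1 * (n * (n - 1) * (n - 2) / 6) =
      - (n * (n - 1) * (n - 2) / 6 * h ^ 3 - h * (n - 2) * n * (n ^ 2 - 1) / 6) / 2"
  proof -
    have "coeff ([:1, 1:] ^ d) 4 + a1 * coeff ([:1, 1:] ^ d) 3 = - coeff ?Q 3 / 2"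
      using arg_cong[OF product_identity, of "\<lambda>p. coeff p 4"] by (simp add: numeral_eq_Suc)
    then show ?thesis unfolding coeffs n_def .
  qed
  have "n * (n - 1) * (3 * h ^ 2 - 3 * h - 2 * n - 2) = 0"
    using c3 unfolding a1' by (simp add: field_simps) algebra
  then have "3 * h ^ 2 - 3 * h - 2 * n - 2 = 0" using n unfolding mult_eq_0_iff by blast
  then have h2: "3 * h ^ 2 = 3 * h + 2 * n + 2" by (simp add: algebra_simps)
  have "n * (n - 1) * (n - 2) * (2 * h ^ 3 - 2 * h * (n + 2) - n - 1) = 0"
    using c4 unfolding a1' by (simp add: field_simps) algebra
  then have "n - 2 = 0 \<or> 2 * h ^ 3 - 2 * h * (n + 2) - n - 1 = 0"
    using n unfolding mult_eq_0_iff by blast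
  then have "n = 2 \<or> 2 * h ^ 3 = 2 * h * (n + 2) + n + 1" by (simp add: algebra_simps)
  then show ?thesis
  proof
    assume "n = 2"
    then have "d = 2" unfolding n_def by (metis of_nat_eq_iff of_nat_numeral)
    \<comment> \<open>Here \<open>A = h - 3\<close>, so the roots 2 and -1 give the two exceptional
      values of \<open>A\<close>.\<close>
    have "(h - 2) * (h + 1) = 0" using h2 unfolding \<open>n = 2\<close> by algebra
    then show ?thesis using \<open>d = 2\<close> by (auto simp: h_def eq_neg_iff_add_eq_0 add.commute)
  next
    assume h3: "2 * h ^ 3 = 2 * h * (n + 2) + n + 1"
    \<comment> \<open>Reducing \<open>3 * h3\<close> by \<open>h2\<close> removes all powers of
      \<open>h\<close> above the first.\<close>
    have "(n + 1) * (2 * h - 1) = 0" using h2 h3 by algebra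
    moreover have "n + 1 \<noteq> 0" unfolding n_def by (metis of_nat_Suc of_nat_eq_0_iff nat.distinct(1) add.commute)
    ultimately have "2 * h = 1" by simp
    then have "8 * n + 11 = 0" using h2 by algebra
    then have "of_nat (8 * d + 11) = (0 :: complex)" by (simp add: n_def)
    then show ?thesis by (simp only: of_nat_eq_0_iff)
  qed
qed

end

section \<open>Odd maps between two rank one Virasoro modules\<close>

locale odd_map_polys =
  fixes \<delta> lam0 lam1 a0 a1 :: complex and S :: "int \<Rightarrow> complex poly" and r :: "int \<Rightarrow> complex"
  defines "r k \<equiv> of_int k + \<delta>"
  assumes delta: "\<delta> = 0 \<or> \<delta> = 1 / 2" and lam0: "lam0 \<noteq> 0" and lam1: "lam1 \<noteq> 0"
    and rel: "smult (lam1 powi m) [:of_int m * a1, 1:] * shift_poly (of_int m) (S k) -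
      S k * shift_poly (r k) (smult (lam0 powi m) [:of_int m * a0, 1:]) =
      smult (- r k - of_int m / 2) (S (m + k))"
    and ex_nonzero: "\<exists>k. S k \<noteq> 0"
begin

text \<open>A zero spreads from \<open>k\<close> to every \<open>l\<close> not opposite to it, and
  through an intermediate index to the opposite one as well.\<close>

lemma nonzero: "S k \<noteq> 0"
proof
  assume 0: "S k = 0"
  have step: "S l = 0" if "S k = 0" "r l \<noteq> - r k" for k l
  proof -
    have "smult (- r k - of_int (l - k) / 2) (S l) = 0" using rel[of "l - k" k] that(1) by simp
    moreover have "- r k - of_int (l - k) / 2 = - (r k + r l) / 2" by (simp add: r_def field_simps)
    ultimately have "smult (- (r k + r l) / 2) (S l) = 0" by (simp only:)
    then show ?thesis using that(2) by (auto simp: add_eq_0_iff)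
  qed
  have "S l = 0" for l
  proof -
    have "infinite (range r)"
      using finite_imageD[of r UNIV] by (auto simp: r_def inj_def infinite_UNIV_int)
    then have "range r - {- r k, - r l} \<noteq> {}" by (metis Diff_eq_empty_iff finite.simps finite_subset)
    then obtain j where "r j \<noteq> - r k" "r j \<noteq> - r l" by blast
    then have "r j \<noteq> - r k" "r l \<noteq> - r j" by auto
    then show ?thesis using step 0 by blast
  qed
  then show False using ex_nonzero by blast
qed

lemma top_coeff:
  "(lam1 powi m - lam0 powi m) * lead_coeff (S k) =
    (- r k - of_int m / 2) * coeff (S (m + k)) (Suc (degree (S k)))"
proof -
  have "coeff (shift_poly (of_int m) (S k)) (Suc (degree (S k))) = 0" by (simp add: coeff_eq_0)
  then have "(lam1 powi m - lam0 powi m) * lead_coeff (S k) =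
    coeff (smult (- r k - of_int m / 2) (S (m + k))) (Suc (degree (S k)))"
    unfolding rel[symmetric]
    by (simp add: shift_poly_linear lead_coeff_shift_poly coeff_eq_0 mult.commute[of "S k"] algebra_simps)
  then show ?thesis by simp
qed

text \<open>Otherwise the degree would rise strictly from index 0 to -1 and again on the way back.
  Steps of size one are used because higher powers of distinct scalars may coincide.\<close>

lemma lam_eq: "lam1 = lam0"
proof (rule ccontr)
  assume neq: "lam1 \<noteq> lam0"
  have "degree (S (m + k)) > degree (S k)" if "m = 1 \<or> m = -1" for m k
  proof -
    have "lam1 powi m - lam0 powi m \<noteq> 0" using that neq lam0 lam1 by (auto simp: power_int_minus)
    then have "coeff (S (m + k)) (Suc (degree (S k))) \<noteq> 0" using top_coeff[of m k] nonzero[of k] by auto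
    then show ?thesis using le_degree by (metis Suc_le_eq)
  qed
  from this[of "-1" 0] this[of 1 "-1"] show False by simp
qed

definition s where "s k = smult (lam0 powi (- k)) (S k)"

sublocale normalized: odd_polys \<delta> a0 a1 s r
proof (unfold_locales, unfold r_def[symmetric])
  fix m k
  show "\<delta> = 0 \<or> \<delta> = 1 / 2" by (rule delta)
  show "s k \<noteq> 0" using nonzero lam0 by (simp add: s_def)
  let ?X = "[:of_int m * a1, 1:] * shift_poly (of_int m) (S k) - [:r k + of_int m * a0, 1:] * S k"
  have "smult (lam0 powi m) ?X = smult (- (r k + of_int m / 2)) (S (m + k))"
    using rel[of m k] unfolding lam_eq
    by (simp only: shift_poly_smult shift_poly_linear mult_smult_left mult_smult_right
        smult_diff_right mult.commute[of "S k"] mult_1_left add.commute[of _ "r k"]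
        minus_add_distrib diff_conv_add_uminus smult_add_right smult_minus_right)
  then have "smult (lam0 powi (- (m + k)) * lam0 powi m) ?X =
      smult (- (r k + of_int m / 2)) (s (m + k))"
    unfolding s_def by (metis mult.commute smult_smult)
  moreover have "lam0 powi (- (m + k)) * lam0 powi m = lam0 powi (- k)"
    using lam0 by (simp flip: power_int_add)
  ultimately show "[:of_int m * a1, 1:] * shift_poly (of_int m) (s k) -
      [:r k + of_int m * a0, 1:] * s k = smult (- (r k + of_int m / 2)) (s (m + k))"
    unfolding s_def by (simp only: shift_poly_smult mult_smult_right smult_diff_right)
qed

theorem classification:
  obtains d A b where "lam1 = lam0" "b \<noteq> 0"
    "\<And>k. S k = smult (b * lam0 powi k) (ladder_poly A d (r k))"
    "a0 = (1 - A) / 2" "a1 = - A / 2 - of_nat d"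
    "d = 0 \<or> d = 1 \<or> d = 2 \<and> (A = - 1 \<or> A = - 4)"
proof
  show "S k = smult (normalized.b * lam0 powi k) (ladder_poly normalized.A normalized.d (r k))" for k
  proof -
    have "S k = smult (lam0 powi k) (s k)"
      using lam0 by (simp add: s_def power_int_minus)
    then show ?thesis using normalized.S_eq[of k] by (simp add: mult.commute)
  qed
qed (rule lam_eq normalized.b_nonzero normalized.a0 normalized.a1 normalized.ladder_parameters)+

end

section \<open>Free modules as families of polynomials\<close>

locale linear_operator = vector_space s
  for s :: "complex \<Rightarrow> 'v::ab_group_add \<Rightarrow> 'v" +
  fixes T :: "'v \<Rightarrow> 'v"
  assumes linear_T: "Vector_Spaces.linear s s T"
begin

lemma op_poly_sum:
  assumes "degree p \<le> n"
  shows "op_poly s T p v = (\<Sum>k\<le>n. s (coeff p k) ((T ^^ k) v))"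
  unfolding op_poly_def using assms
  by (intro sum.mono_neutral_left) (auto simp: coeff_eq_0)

lemma op_poly_add: "op_poly s T (p + q) v = op_poly s T p v + op_poly s T q v"
proof -
  have "degree (p + q) \<le> max (degree p) (degree q)" by (rule degree_add_le_max)
  then show ?thesis
    using op_poly_sum[of "p + q"] op_poly_sum[of p "max (degree p) (degree q)"]
      op_poly_sum[of q "max (degree p) (degree q)"]
    by (simp add: sum.distrib scale_left_distrib)
qed

lemma op_poly_smult: "op_poly s T (smult a p) v = s a (op_poly s T p v)"
  using op_poly_sum[OF degree_smult_le, of a p v] by (simp add: op_poly_def scale_sum_right)

lemma op_poly_0 [simp]: "op_poly s T 0 v = 0"
  by (simp add: op_poly_def)

lemma op_poly_diff: "op_poly s T (p - q) v = op_poly s T p v - op_poly s T q v"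
  using op_poly_add[of "p - q" q v] by simp

lemma op_poly_pCons: "op_poly s T (pCons a p) v = s a v + T (op_poly s T p v)"
proof -
  interpret T: Vector_Spaces.linear s s T by (rule linear_T)
  show ?thesis
    unfolding op_poly_sum[OF degree_pCons_le]
    by (simp add: sum.atMost_Suc_shift op_poly_def T.sum T.scale del: sum.atMost_Suc)
qed

lemma op_poly_1 [simp]: "op_poly s T 1 v = v"
  by (simp add: op_poly_def)

lemma op_poly_mult: "op_poly s T (p * q) v = op_poly s T p (op_poly s T q v)"
  by (induction p) (simp_all add: op_poly_pCons op_poly_add op_poly_smult)

text \<open>\<open>U T = (T + c) U\<close> gives \<open>U f(T) = f(T + c) U\<close>; this is the
  origin of all translates.\<close>

lemma op_poly_intertwine:
  assumes U: "Vector_Spaces.linear s s U" and UT: "\<And>v. U (T v) = T (U v) + s c (U v)"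
  shows "U (op_poly s T f v) = op_poly s T (shift_poly c f) (U v)"
proof (induction f)
  case 0
  interpret U: Vector_Spaces.linear s s U by (rule U)
  show ?case by (simp add: U.zero)
next
  case (pCons a f)
  interpret U: Vector_Spaces.linear s s U by (rule U)
  interpret T: Vector_Spaces.linear s s T by (rule linear_T)
  show ?case
    using pCons.IH
    by (simp add: op_poly_pCons shift_poly_pCons op_poly_add op_poly_smult U.add U.scale UT T.zero)
qed

end

section \<open>Generators of the Fermion-Virasoro algebra and their action on a free module\<close>

lemma fv_scale_single: "fv_scale a (Poly_Mapping.single g b) = Poly_Mapping.single g (a * b)"
  unfolding fv_scale_def by (rule poly_mapping_eqI) (simp add: Poly_Mapping.map.rep_eq lookup_single when_def)

lemma fv_brk_gen: "brk (fermion_virasoro \<delta>) (gen g) (gen h) = fv_brk_gen \<delta> g h"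
proof -
  have "fv_scale 1 x = x" for x
    unfolding fv_scale_def by (rule poly_mapping_eqI) (simp add: Poly_Mapping.map.rep_eq when_def)
  then show ?thesis by (simp add: fermion_virasoro_def fv_extend_def)
qed

lemma gen_part: "gen g \<in> part (fermion_virasoro \<delta>) (fv_parity g)"
  by (simp add: fermion_virasoro_def)

lemma fv_sum_gens: "x = (\<Sum>g\<in>Poly_Mapping.keys x. fv_scale (Poly_Mapping.lookup x g) (gen g))"
proof (rule poly_mapping_eqI)
  fix g
  show "Poly_Mapping.lookup x g =
    Poly_Mapping.lookup (\<Sum>g\<in>Poly_Mapping.keys x. fv_scale (Poly_Mapping.lookup x g) (gen g)) g"
    by (simp add: fv_scale_single lookup_sum lookup_single when_def in_keys_iff)
qed

text \<open>Minus the eigenvalue of \<open>ad L_0\<close>, hence the amount by which the generator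
  translates polynomials.\<close>

fun fv_weight :: "complex \<Rightarrow> fv_gen \<Rightarrow> complex" where
  "fv_weight \<delta> (L m) = of_int m"
| "fv_weight \<delta> (Psi k) = of_int k + \<delta>"
| "fv_weight \<delta> Cc = 0"
| "fv_weight \<delta> Zz = 0"

lemma bit_add_self [simp]: "(i :: bit) + j + j = i"
  by (cases i; cases j) auto

locale free_fv_module = lie_super_module "fermion_virasoro \<delta>" V
  for \<delta> :: complex and V :: "(fv, 'v::ab_group_add) super_module" +
  fixes w :: "bit \<Rightarrow> 'v"
  assumes delta: "\<delta> = 0 \<or> \<delta> = 1 / 2"
    and basis: "bij_betw (\<lambda>p. op_poly (scl V) (act V (gen (L 0))) p (w i)) UNIV (part V i)"
begin

sublocale L0: linear_operator "scl V" "act V (gen (L 0))"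
  by (intro linear_operator.intro linear_operator_axioms.intro V.vector_space_axioms linear_act_right)

definition E :: "bit \<Rightarrow> complex poly \<Rightarrow> 'v" where
  "E i p = op_poly (scl V) (act V (gen (L 0))) p (w i)"

lemmas E_add = L0.op_poly_add[of _ _ "w _", folded E_def]
  and E_diff = L0.op_poly_diff[of _ _ "w _", folded E_def]
  and E_smult = L0.op_poly_smult[of _ _ "w _", folded E_def]
  and E_pCons = L0.op_poly_pCons[of _ _ "w _", folded E_def]

lemma E_0 [simp]: "E i 0 = 0" and E_1: "E i 1 = w i"
  by (simp_all add: E_def)

lemma bij_E: "bij_betw (E i) UNIV (part V i)"
  using basis[of i] by (simp add: E_def[abs_def])

lemma E_part: "E i p \<in> part V i"
  using bij_E[of i] by (auto simp: bij_betw_def)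

lemma E_inject: "E i p = E i q \<longleftrightarrow> p = q"
  using bij_E[of i] by (auto simp: bij_betw_def inj_on_def)

lemma E_surj: "v \<in> part V i \<Longrightarrow> \<exists>p. v = E i p"
  using bij_E[of i] by (auto simp: bij_betw_def)

lemma act_scale_left: "act V (fv_scale a x) v = scl V a (act V x v)"
  and act_add_left: "act V (x + y) v = act V x v + act V y v"
  and act_0_left [simp]: "act V 0 v = 0"
proof -
  interpret l: Vector_Spaces.linear fv_scale "scl V" "\<lambda>x. act V x v"
    using linear_act_left by (simp add: fermion_virasoro_def)
  show "act V (fv_scale a x) v = scl V a (act V x v)" "act V (x + y) v = act V x v + act V y v"
    "act V 0 v = 0"
    using l.scale l.add l.zero by simp_all
qed

lemma act_add_right: "act V x (u + v) = act V x u + act V x v"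
  and act_0_right [simp]: "act V x 0 = 0"
proof -
  interpret l: Vector_Spaces.linear "scl V" "scl V" "act V x" by (rule linear_act_right)
  show "act V x (u + v) = act V x u + act V x v" "act V x 0 = 0" by (rule l.add l.zero)+
qed

lemma act_gens: "act V x v = fv_extend (scl V) (\<lambda>g. act V (gen g) v) x"
proof -
  interpret l: Vector_Spaces.linear fv_scale "scl V" "\<lambda>x. act V x v"
    using linear_act_left by (simp add: fermion_virasoro_def)
  show ?thesis
    by (subst fv_sum_gens) (simp add: l.sum l.scale fv_extend_def)
qed

lemma act_brk_gen:
  "act V (fv_brk_gen \<delta> g h) v = act V (gen g) (act V (gen h) v) -
    scl V (super_sign (fv_parity g) (fv_parity h)) (act V (gen h) (act V (gen g) v))"
  using act_brk[OF gen_part gen_part, of g h v] by (simp add: fv_brk_gen)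

lemma gen_L0: "act V (gen g) (act V (gen (L 0)) v) =
  act V (gen (L 0)) (act V (gen g) v) + scl V (fv_weight \<delta> g) (act V (gen g) v)"
proof -
  have "fv_brk_gen \<delta> (L 0) g = fv_scale (- fv_weight \<delta> g) (gen g)"
    by (cases g) (simp_all add: fv_scale_single)
  then have "scl V (- fv_weight \<delta> g) (act V (gen g) v) = act V (gen (L 0)) (act V (gen g) v) -
      act V (gen g) (act V (gen (L 0)) v)"
    using act_brk_gen[of "L 0" g v] by (simp add: super_sign_def act_scale_left)
  then show ?thesis by (simp add: algebra_simps)
qed

lemma ex_act_poly:
  "\<exists>q. \<forall>f. act V (gen g) (E i f) = E (i + fv_parity g) (q * shift_poly (fv_weight \<delta> g) f)"
proof -
  have "act V (gen g) (w i) \<in> part V (i + fv_parity g)"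
    using act_part[OF gen_part E_part, of g i 1] by (simp only: E_1 add.commute)
  then obtain q where q: "act V (gen g) (w i) = E (i + fv_parity g) q" using E_surj by blast
  have "act V (gen g) (E i f) = E (i + fv_parity g) (q * shift_poly (fv_weight \<delta> g) f)" for f
    unfolding E_def L0.op_poly_intertwine[OF linear_act_right gen_L0] q
    by (simp only: E_def L0.op_poly_mult[symmetric] mult.commute)
  then show ?thesis by blast
qed

text \<open>The choice is unambiguous: \<open>f = 1\<close> shows that \<open>Q i g\<close> is the
  coordinate of \<open>g\<close> applied to \<open>w i\<close>, and \<open>E\<close> is
  injective.\<close>

definition Q :: "bit \<Rightarrow> fv_gen \<Rightarrow> complex poly" where
  "Q i g = (SOME q. \<forall>f. act V (gen g) (E i f) =
    E (i + fv_parity g) (q * shift_poly (fv_weight \<delta> g) f))"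

lemma act_E: "act V (gen g) (E i f) = E (i + fv_parity g) (Q i g * shift_poly (fv_weight \<delta> g) f)"
  using someI_ex[OF ex_act_poly[of g i]] unfolding Q_def by blast

lemma Q_L0: "Q i (L 0) = [:0, 1:]"
proof -
  have "E i (Q i (L 0)) = E i [:0, 1:]"
    using act_E[of "L 0" i 1] by (simp add: E_pCons flip: one_pCons)
  then show ?thesis by (simp only: E_inject)
qed

lemma act_E_1: "act V (gen g) (E i 1) = E (i + fv_parity g) (Q i g)"
  by (simp add: act_E)

text \<open>Source of all relations between the \<open>Q i g\<close>: injectivity of
  \<open>E\<close> turns each bracket of generators into an equation of polynomials.\<close>

lemma bracket_poly:
  "act V (fv_brk_gen \<delta> g h) (E i 1) = E (i + fv_parity g + fv_parity h)
    (Q (i + fv_parity h) g * shift_poly (fv_weight \<delta> g) (Q i h) -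
     smult (super_sign (fv_parity g) (fv_parity h))
       (Q (i + fv_parity g) h * shift_poly (fv_weight \<delta> h) (Q i g)))"
proof -
  have "i + fv_parity h + fv_parity g = i + fv_parity g + fv_parity h" by (simp only: ac_simps)
  then show ?thesis unfolding act_brk_gen act_E_1 act_E E_diff E_smult
    by (simp only: shift_poly_1 mult_1_right)
qed

sublocale even: virasoro_polys "\<lambda>m. Q i (L m)" "Q i Cc" for i
proof
  fix m n :: int
  show "Q i (L 0) = [:0, 1:]" by (rule Q_L0)
  have "E i (Q i (L m) * shift_poly (of_int m) (Q i (L n)) - Q i (L n) * shift_poly (of_int n) (Q i (L m)))
    = act V (fv_brk_gen \<delta> (L m) (L n)) (E i 1)"
    unfolding bracket_poly by (simp add: super_sign_def)
  also have "\<dots> = E i (smult (of_int (m - n)) (Q i (L (m + n))) +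
      (if m = - n then smult (of_int (m ^ 3 - m) / 12) (Q i Cc) else 0))"
    by (simp add: act_add_left act_scale_left act_E_1 E_add E_smult)
  finally show "Q i (L m) * shift_poly (of_int m) (Q i (L n)) - Q i (L n) * shift_poly (of_int n) (Q i (L m)) =
      smult (of_int (m - n)) (Q i (L (m + n))) +
      (if m = - n then smult (of_int (m ^ 3 - m) / 12) (Q i Cc) else 0)"
    by (simp only: E_inject)
  have "E i (Q i (L m) * shift_poly (of_int m) (Q i Cc) - Q i Cc * Q i (L m)) =
      act V (fv_brk_gen \<delta> (L m) Cc) (E i 1)"
    unfolding bracket_poly by (simp add: super_sign_def)
  also have "\<dots> = E i 0" by simp
  finally show "Q i (L m) * shift_poly (of_int m) (Q i Cc) = Q i Cc * Q i (L m)"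
    unfolding E_inject by simp
qed

lemma L_Psi_rel:
  "Q (i + 1) (L m) * shift_poly (of_int m) (Q i (Psi k)) -
    Q i (Psi k) * shift_poly (of_int k + \<delta>) (Q i (L m)) =
    smult (- (of_int k + \<delta>) - of_int m / 2) (Q i (Psi (m + k)))"
proof -
  have "E (i + 1) (Q (i + 1) (L m) * shift_poly (of_int m) (Q i (Psi k)) -
      Q i (Psi k) * shift_poly (of_int k + \<delta>) (Q i (L m))) =
    act V (fv_brk_gen \<delta> (L m) (Psi k)) (E i 1)"
    unfolding bracket_poly by (simp add: super_sign_def)
  also have "\<dots> = E (i + 1) (smult (- (of_int k + \<delta>) - of_int m / 2) (Q i (Psi (m + k))))"
    by (simp add: act_scale_left act_E_1 E_smult)
  finally show ?thesis by (simp only: E_inject)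
qed

lemma Psi_Psi_rel:
  "Q (i + 1) (Psi j) * shift_poly (of_int j + \<delta>) (Q i (Psi k)) +
    Q (i + 1) (Psi k) * shift_poly (of_int k + \<delta>) (Q i (Psi j)) =
    (if of_int j + \<delta> = - (of_int k + \<delta>) then Q i Zz else 0)"
proof -
  have "E i (Q (i + 1) (Psi j) * shift_poly (of_int j + \<delta>) (Q i (Psi k)) +
      Q (i + 1) (Psi k) * shift_poly (of_int k + \<delta>) (Q i (Psi j))) =
    act V (fv_brk_gen \<delta> (Psi j) (Psi k)) (E i 1)"
    unfolding bracket_poly by (simp add: super_sign_def)
  also have "\<dots> = E i (if of_int j + \<delta> = - (of_int k + \<delta>) then Q i Zz else 0)"
    by (simp add: act_E_1)
  finally show ?thesis by (simp only: E_inject)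
qed

lemma spanned: "\<exists>f g. v = E i f + E (i + 1) g"
proof -
  obtain u0 u1 where u: "u0 \<in> part V 0" "u1 \<in> part V 1" "v = u0 + u1"
    using V.part_sum by blast
  then obtain f g where fg: "v = E 0 f + E 1 g" using E_surj by blast
  show ?thesis
  proof (cases i)
    case zero
    then show ?thesis using fg by auto
  next
    case one
    then show ?thesis using fg by (auto simp: add.commute)
  qed
qed

lemma ex_Psi_nonzero:
  assumes "x \<in> part (fermion_virasoro \<delta>) 1" "act V x v \<noteq> 0"
  shows "\<exists>i k. Q i (Psi k) \<noteq> 0"
proof (rule ccontr)
  assume "\<not> ?thesis"
  then have Q0: "Q i (Psi k) = 0" for i k by blast
  have "act V (gen (Psi k)) v = 0" for k
    using spanned[of v 0] by (auto simp: act_add_right act_E Q0)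
  moreover have "\<exists>k. g = Psi k" if "g \<in> Poly_Mapping.keys x" for g
    using assms(1) that by (cases g) (auto simp: fermion_virasoro_def)
  ultimately have "act V x v = 0"
    unfolding act_gens[of x] fv_extend_def by (intro sum.neutral) fastforce
  with assms(2) show False by contradiction
qed

end

section \<open>Isomorphism with a module of pairs of polynomials\<close>

lemma vector_space_pair_scale: "vector_space pair_scale"
  by unfold_locales (simp_all add: pair_scale_def smult_add_right smult_add_left prod_eq_iff)

context free_fv_module
begin

text \<open>In the application the first component carries the parity on which the odd generators
  are nonzero; \<open>i = 1\<close> is then the parity-changed case.\<close>

definition pair_elem :: "bit \<Rightarrow> complex poly \<times> complex poly \<Rightarrow> 'v" where
  "pair_elem i u = E i (fst u) + E (i + 1) (snd u)"

lemma bij_pair_elem: "bij (pair_elem i)"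
proof (rule bijI)
  show "inj (pair_elem i)"
  proof (rule injI)
    fix u u' assume "pair_elem i u = pair_elem i u'"
    then have eq: "E i (fst u - fst u') = E (i + 1) (snd u' - snd u)"
      by (simp add: pair_elem_def E_diff algebra_simps)
    moreover have "part V i \<inter> part V (i + 1) = {0}"
      using V.part_disjoint by (cases i) auto
    ultimately have "E i (fst u - fst u') = 0" using E_part by (metis IntI singletonD)
    then have "fst u - fst u' = 0" "snd u' - snd u = 0"
      using eq E_0 E_inject by metis+
    then show "u = u'" by (simp add: prod_eq_iff)
  qed
  show "surj (pair_elem i)"
    using spanned[of _ i] by (simp add: surj_def pair_elem_def split_paired_Ex)
qed

lemma pair_elem_linear: "Vector_Spaces.linear pair_scale (scl V) (pair_elem i)"
  unfolding Vector_Spaces.linear_iff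
  using vector_space_pair_scale V.vector_space_axioms
  by (auto simp: pair_elem_def pair_scale_def E_add E_smult V.scale_right_distrib)

lemma iso_poly_module:
  assumes even: "\<And>m. Q i (L m) = smult (lam powi m) (p (of_int m))"
    and even': "\<And>m. Q (i + 1) (L m) = smult (lam powi m) (q (of_int m))"
    and odd: "\<And>k. Q i (Psi k) = smult (b * lam_pow \<rho> \<delta> lam k) (s (of_int k + \<delta>))"
    and odd': "\<And>k. Q (i + 1) (Psi k) = 0"
    and central: "\<And>j. Q j Cc = 0" "\<And>j. Q j Zz = 0"
  shows "iso_up_to_parity V (poly_module \<rho> \<delta> lam b p q s)"
proof -
  let ?W = "poly_module \<rho> \<delta> lam b p q s"
  define \<phi> where "\<phi> = inv (pair_elem i)"
  have inv1: "\<phi> (pair_elem i u) = u" for u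
    unfolding \<phi>_def using bij_pair_elem[of i] by (simp add: bij_is_inj inv_f_f)
  have inv2: "pair_elem i (\<phi> v) = v" for v
    unfolding \<phi>_def using bij_pair_elem[of i] by (simp add: bij_is_surj surj_f_inv_f)
  have bij: "bij \<phi>" unfolding \<phi>_def by (rule bij_imp_bij_inv[OF bij_pair_elem])
  interpret P: Vector_Spaces.linear pair_scale "scl V" "pair_elem i" by (rule pair_elem_linear)
  have lin: "Vector_Spaces.linear (scl V) pair_scale \<phi>"
    unfolding Vector_Spaces.linear_iff
  proof (intro conjI allI)
    show "\<phi> (x + y) = \<phi> x + \<phi> y" for x y
      using inv1[of "\<phi> x + \<phi> y"] by (simp add: P.add inv2)
    show "\<phi> (scl V c x) = pair_scale c (\<phi> x)" for c x
      using inv1[of "pair_scale c (\<phi> x)"] by (simp add: P.scale inv2)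
  qed (rule V.vector_space_axioms vector_space_pair_scale)+
  interpret F: Vector_Spaces.linear "scl V" pair_scale \<phi> by (rule lin)
  have gen: "act V (gen g) (pair_elem i u) = pair_elem i (poly_act_gen \<rho> \<delta> lam b p q s g u)" for g u
  proof (cases u)
    case (Pair f h)
    then show ?thesis
      by (cases g) (simp_all add: pair_elem_def act_add_right act_E even even' odd odd' central
          del: add_bit_eq_xor)
  qed
  have act: "\<phi> (act V x v) = act ?W x (\<phi> v)" for x v
  proof -
    have "\<phi> (act V (gen g) v) = poly_act_gen \<rho> \<delta> lam b p q s g (\<phi> v)" for g
      using gen[of g "\<phi> v"] by (simp add: inv2 inv1)
    then show ?thesis
      unfolding act_gens[of x] by (simp add: fv_extend_def F.sum F.scale poly_module_def)
  qed
  have part: "\<phi> ` part V i = {(f, 0) | f. True}" "\<phi> ` part V (i + 1) = {(0, g) | g. True}"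
  proof -
    have "E i f = pair_elem i (f, 0)" "E (i + 1) f = pair_elem i (0, f)" for f
      by (simp_all add: pair_elem_def)
    then have "\<phi> (E i f) = (f, 0)" "\<phi> (E (i + 1) f) = (0, f)" for f by (simp_all add: inv1)
    moreover have "part V j = range (E j)" for j using bij_E[of j] by (auto simp: bij_betw_def)
    ultimately show "\<phi> ` part V i = {(f, 0) | f. True}" "\<phi> ` part V (i + 1) = {(0, g) | g. True}"
      by (auto simp: image_iff)
  qed
  show ?thesis
  proof (cases i)
    case zero
    have "\<phi> ` part V j = part ?W j" for j
      using part by (cases j) (auto simp: zero poly_module_def)
    then have "super_module_iso V ?W"
      unfolding super_module_iso_def using lin bij act
      by (intro exI[of _ \<phi>]) (simp add: poly_module_def)
    then show ?thesis by (simp add: iso_up_to_parity_def)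
  next
    case one
    have "\<phi> ` part V j = part (parity_change ?W) j" for j
      using part by (cases j) (auto simp: one poly_module_def parity_change_def)
    then have "super_module_iso V (parity_change ?W)"
      unfolding super_module_iso_def using lin bij act
      by (intro exI[of _ \<phi>]) (simp add: poly_module_def parity_change_def)
    then show ?thesis by (simp add: iso_up_to_parity_def)
  qed
qed

lemma odd_map_polys:
  assumes "lam0 \<noteq> 0" "\<And>m. Q i (L m) = smult (lam0 powi m) [:of_int m * a0, 1:]"
    and "lam1 \<noteq> 0" "\<And>m. Q (i + 1) (L m) = smult (lam1 powi m) [:of_int m * a1, 1:]"
    and "Q i (Psi k) \<noteq> 0"
  shows "odd_map_polys \<delta> lam0 lam1 a0 a1 (\<lambda>k. Q i (Psi k))"
  using assms delta L_Psi_rel[of i]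
  by unfold_locales auto

theorem classification:
  assumes "Q i (Psi k) \<noteq> 0" and \<rho>: "\<And>lam. lam \<noteq> 0 \<Longrightarrow> (\<rho> lam)\<^sup>2 = lam"
  shows "\<exists>lam b. lam \<noteq> 0 \<and> b \<noteq> 0 \<and>
    ((\<exists>a. iso_up_to_parity V (Omega \<rho> \<delta> lam a b)) \<or>
     (\<exists>a. iso_up_to_parity V (Omega' \<rho> \<delta> lam a b)) \<or>
     iso_up_to_parity V (Omega'' \<rho> \<delta> lam b) \<or>
     iso_up_to_parity V (Omega_tilde'' \<rho> \<delta> lam b))"
proof -
  obtain lam a0 where lam: "lam \<noteq> 0" and L0: "\<And>m. Q i (L m) = smult (lam powi m) [:of_int m * a0, 1:]"
    by (rule even.classification[of i]) (rule that)
  obtain lam1 a1 where lam1: "lam1 \<noteq> 0"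
    and L1: "\<And>m. Q (i + 1) (L m) = smult (lam1 powi m) [:of_int m * a1, 1:]"
    by (rule even.classification[of "i + 1"]) (rule that)
  interpret S: odd_map_polys \<delta> lam lam1 a0 a1 "\<lambda>k. Q i (Psi k)" "\<lambda>k. of_int k + \<delta>"
    using odd_map_polys[OF lam L0 lam1 L1 assms(1)] by simp
  \<comment> \<open>\<open>Psi 1\<close> has nonzero index for both \<delta>, so its square is 0,
    whereas \<open>Psi 0\<close> squares to \<open>z / 2\<close> when \<delta> is 0. A product of
    two nonzero polynomials cannot vanish.\<close>
  have other: "Q (i + 1) (Psi l) = 0" for l
  proof (rule ccontr)
    assume "Q (i + 1) (Psi l) \<noteq> 0"
    then have "odd_map_polys \<delta> lam1 lam a1 a0 (\<lambda>k. Q (i + 1) (Psi k))"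
      using lam lam1 L0 L1 by (intro odd_map_polys) (simp_all only: bit_add_self not_False_eq_True)
    then have "Q (i + 1) (Psi 1) \<noteq> 0" by (rule odd_map_polys.nonzero)
    moreover have "(1 :: complex) + \<delta> \<noteq> - (1 + \<delta>)" using delta by (elim disjE; simp only:) simp_all
    then have "Q (i + 1) (Psi 1) * shift_poly (1 + \<delta>) (Q i (Psi 1)) = 0"
      using Psi_Psi_rel[of i 1 1] by simp
    ultimately show False using S.nonzero by simp
  qed
  have Cc: "Q j Cc = 0" for j by (rule even.classification[of j])
  have Zz: "Q j Zz = 0" for j
  proof -
    \<comment> \<open>\<open>Psi l\<close> has the index opposite to \<open>Psi 0\<close>, so their
      bracket is \<open>z\<close>; each product in it contains a factor from the parity killed by
      \<open>other\<close>.\<close>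
    define l :: int where "l = (if \<delta> = 0 then 0 else - 1)"
    have "of_int 0 + \<delta> = - (of_int l + \<delta>)" using delta by (auto simp: l_def field_simps)
    moreover have "j = i \<or> j = i + 1" by (cases i; cases j) auto
    ultimately show ?thesis
      using Psi_Psi_rel[of j 0 l] other by (auto simp del: add_bit_eq_xor)
  qed
  obtain d A b where "lam1 = lam" and b: "b \<noteq> 0"
    and S: "\<And>k. Q i (Psi k) = smult (b * lam powi k) (ladder_poly A d (of_int k + \<delta>))"
    and a0: "a0 = (1 - A) / 2" and a1: "a1 = - A / 2 - of_nat d"
    and dA: "d = 0 \<or> d = 1 \<or> d = 2 \<and> (A = - 1 \<or> A = - 4)"
    by (rule S.classification) (rule that)
  \<comment> \<open>For half-integral indices \<open>lam_pow\<close> carries an extra square root of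
    \<lambda>, which the constant has to absorb.\<close>
  define b' where "b' = (if \<delta> = 0 then b else b / \<rho> lam)"
  have "\<rho> lam \<noteq> 0" using \<rho>[OF lam] lam by auto
  then have b': "b' \<noteq> 0" and b'_pow: "b * lam powi k = b' * lam_pow \<rho> \<delta> lam k" for k
    using b by (auto simp: b'_def lam_pow_def)
  have iso: "iso_up_to_parity V (poly_module \<rho> \<delta> lam b' p q s)"
    if "\<And>m. p m = [:m * a0, 1:]" "\<And>m. q m = [:m * a1, 1:]" "\<And>r. s r = ladder_poly A d r" for p q s
    by (rule iso_poly_module[of i]) (simp_all only: that L0 L1 \<open>lam1 = lam\<close> S b'_pow other Cc Zz)
  note ladder = ladder_poly_def lessThan_Suc numeral_2_eq_2
  from dA have "(\<exists>a. iso_up_to_parity V (Omega \<rho> \<delta> lam a b')) \<or>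
     (\<exists>a. iso_up_to_parity V (Omega' \<rho> \<delta> lam a b')) \<or>
     iso_up_to_parity V (Omega'' \<rho> \<delta> lam b') \<or>
     iso_up_to_parity V (Omega_tilde'' \<rho> \<delta> lam b')"
  proof (elim disjE conjE)
    assume "d = 0"
    then have "iso_up_to_parity V (Omega \<rho> \<delta> lam a0 b')"
      unfolding Omega_def by (intro iso) (simp_all add: a0 a1 ladder field_simps)
    then show ?thesis by blast
  next
    assume "d = 1"
    then have "iso_up_to_parity V (Omega' \<rho> \<delta> lam a0 b')"
      unfolding Omega'_def by (intro iso) (simp_all add: a0 a1 ladder field_simps)
    then show ?thesis by blast
  next
    \<comment> \<open>Here \<open>a0 = 1\<close> and \<open>a1 = -3/2\<close>, and the ladder is
      \<open>(x + r) (x + 3 r)\<close>.\<close>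
    assume "d = 2" "A = - 1"
    then have "iso_up_to_parity V (Omega'' \<rho> \<delta> lam b')"
      unfolding Omega''_def by (intro iso) (simp_all add: a0 a1 ladder field_simps)
    then show ?thesis by blast
  next
    \<comment> \<open>Here \<open>a0 = 5/2\<close> and \<open>a1 = 0\<close>, and the ladder is
      \<open>(x - 2 r) x\<close>.\<close>
    assume "d = 2" "A = - 4"
    then have "iso_up_to_parity V (Omega_tilde'' \<rho> \<delta> lam b')"
      unfolding Omega_tilde''_def by (intro iso) (simp_all add: a0 a1 ladder field_simps)
    then show ?thesis by blast
  qed
  with lam b' show ?thesis by blast
qed

end

theorem theorem6p12:
  fixes \<delta> :: complex
    and \<rho> :: "complex \<Rightarrow> complex"
    and V :: "(fv, 'v::ab_group_add) super_module"
  assumes "\<delta> \<in> {0, 1/2}"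
    and "\<And>lam. lam \<noteq> 0 \<Longrightarrow> (\<rho> lam)\<^sup>2 = lam"
    and "lie_super_module (fermion_virasoro \<delta>) V"
    and "\<And>i. free_rank_one (scl V) (act V (gen (L 0))) (part V i)"
    and "\<exists>x\<in>part (fermion_virasoro \<delta>) 1. \<exists>v. act V x v \<noteq> 0"
  shows "\<exists>lam b. lam \<noteq> 0 \<and> b \<noteq> 0 \<and>
    ((\<exists>a. iso_up_to_parity V (Omega \<rho> \<delta> lam a b)) \<or>
     (\<exists>a. iso_up_to_parity V (Omega' \<rho> \<delta> lam a b)) \<or>
     iso_up_to_parity V (Omega'' \<rho> \<delta> lam b) \<or>
     iso_up_to_parity V (Omega_tilde'' \<rho> \<delta> lam b))"
proof -
  obtain w where w:
    "\<And>i. bij_betw (\<lambda>p. op_poly (scl V) (act V (gen (L 0))) p (w i)) UNIV (part V i)"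
    using assms(4) unfolding free_rank_one_def by metis
  interpret lie_super_module "fermion_virasoro \<delta>" V by (rule assms(3))
  interpret free_fv_module \<delta> V w
    using assms(1) w by unfold_locales auto
  obtain i k where "Q i (Psi k) \<noteq> 0" using assms(5) ex_Psi_nonzero by blast
  then show ?thesis using assms(2) by (rule classification)
qed

end
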